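(* Let $n,l$ be positive integers. For $1\le i\le n$ let $G_i=(G_{i1},\dots,G_{il})\in k^l[[X_1,\dots,X_n]]$ and let $G=(G_{ij})_{1\le i\le n,\,1\le j\le l}$. Let $\Lambda:k^n\to k^n$ be additive, $k'$-linear and non-expanding (i.e. $\|\Lambda w\|\le\|w\|$ for all $w\in k^n$). Assume that for some $(r_1,\dots,r_n)\in\mathbb{R}_+^n$ (all $r_i>0$) each $G_i$ is convergent in $B(0,r_i)$, set $M_i=\|G_i\|_{r_i}>0$, $r=\min_i r_i$ and $M=\max_i M_i$. Then for $u\in B_0(0,r/M)\subset k^l$ and $w\in B_0(0,r)\subset k^n$ the equation $$h=\Lambda\left[w+G(h)\cdot u\right],\qquad h\in B_0(0,r)\subset k^n,$$ has the unique solution $$H(u,w)=\Lambda w+\sum_{N\ge1}\ \sum_{\vartheta\in\mathcal{T}_N}\mathrm{Val}_\Lambda(\vartheta)(u,w),$$ where $\mathrm{Val}_\Lambda:\mathcal{T}_N\times B_0(0,r/M)\times B_0(0,r)\to B_0(0,r)$ is defined in the context. Moreover, for any fixed $\vartheta$ the function $(u,w)\mapsto \mathrm{Val}_\Lambda(\vartheta)(u,w)$ is continuous, the series converges on $B_0(0,r/M)\times B_0(0,r)$, and the map $(u,w)\mapsto H(u,w)\in B_0(0,r)$ is continuous.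
   Context: $(k,|\cdot|)$ is a field of characteristic zero, complete with respect to a non-trivial ultrametric absolute value ($|x+y|\le\sup(|x|,|y|)$). $k'$ denotes its residue field; $k'$-linearity of a map on $k^n$ presupposes that $k'$ is identified with a subfield of $k$ (as for formal Laurent series over a field). For any $m$, $k^m$ carries the norm $\|x\|=\sup_i|x_i|$; $B_0(x,\rho)=\{y:\|x-y\|<\rho\}$ and $B(x,\rho)$ is the closed ball of radius $\rho$. A power series $F=\sum_{\alpha\in\mathbb{N}^n}F_\alpha X^\alpha$ with coefficients in $k^m$ converges in $B(0,\rho)$ if $\sum_\alpha\|F_\alpha\|\rho^{|\alpha|}<+\infty$, where $|\alpha|=\sum_i\alpha_i$, and $\|F\|_\rho=\sup_\alpha\|F_\alpha\|\rho^{|\alpha|}$; a convergent series is identified with the function it defines. $G(h)\cdot u\in k^n$ is the vector with $i$-th component $\sum_{j=1}^l G_{ij}(h)u_j$. For $t\ge1$ and $v^{(1)},\dots,v^{(t)}\in k^n$, $d^tG(w)(v^{(1)},\dots,v^{(t)})$ is the $n\times l$ matrix with entries $\sum_{l_1,\dots,l_t=1}^n D_{l_1}\cdots D_{l_t}G_{ij}(w)\,v^{(1)}_{l_1}\cdots v^{(t)}_{l_t}$, where $D_i$ is the $i$-th partial derivative. Rooted trees: $\mathcal{T}_N$ is the set of rooted trees with $N$ nodes in which the subtrees attached to each node are ordered. Thus $\mathcal{T}_1$ consists of the single-node tree, and for $N\ge2$ each $\vartheta\in\mathcal{T}_N$ is uniquely written (standard decomposition) as $\vartheta=(t,\vartheta^1,\dots,\vartheta^t)$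 with $t\ge1$ the number of lines entering the root, $\vartheta^i\in\mathcal{T}_{N_i}$ and $N_1+\dots+N_t=N-1$; all such tuples occur. Definition of $\mathrm{Val}_\Lambda$: if $\vartheta\in\mathcal{T}_1$, $\mathrm{Val}_\Lambda(\vartheta)(u,w)=\Lambda\left(G(\Lambda w)\cdot u\right)$; otherwise, with $\vartheta=(t,\vartheta^1,\dots,\vartheta^t)$, $$\mathrm{Val}_\Lambda(\vartheta)(u,w)=\frac1{t!}\Lambda\left[d^tG(\Lambda w)\left(\mathrm{Val}_\Lambda(\vartheta^1)(u,w),\dots,\mathrm{Val}_\Lambda(\vartheta^t)(u,w)\right)\cdot u\right].$$ *)

theory Defs
  imports "HOL-Analysis.Analysis" "HOL-Algebra.QuotRing" "HOL-Algebra.Subrings"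
begin

section \<open>Complete ultrametric fields of characteristic zero\<close>

text \<open>A separate constant \<open>absval\<close> is needed because the library restricts \<open>norm\<close> to real vector
  spaces. That it is nonnegative and vanishes only at \<open>0\<close> follows from the metric axioms.\<close>

class complete_ultrametric_field = field_char_0 + complete_space +
  fixes absval :: "'a \<Rightarrow> real"
  assumes uf_dist: "dist x y = absval (x - y)"
    and uf_absval_mult: "absval (x * y) = absval x * absval y"
    and uf_absval_add: "absval (x + y) \<le> max (absval x) (absval y)"
    and uf_nontrivial: "\<exists>x. x \<noteq> 0 \<and> absval x \<noteq> 1"

lemma uf_absval_zero [simp]: "absval (0::'a::complete_ultrametric_field) = 0"
  by (metis diff_self uf_dist dist_self)

lemma uf_absval_eq_zero [simp]: "absval (x::'a::complete_ultrametric_field) = 0 \<longleftrightarrow> x = 0"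
  by (metis diff_zero dist_eq_0_iff uf_dist)

lemma uf_absval_nonneg [simp]: "0 \<le> absval (x::'a::complete_ultrametric_field)"
  by (metis diff_zero uf_dist zero_le_dist)

lemma uf_absval_minus [simp]: "absval (- x) = absval (x::'a::complete_ultrametric_field)"
  by (metis diff_0 diff_zero dist_commute uf_dist)

lemma uf_tendstoI:
  fixes l :: "'a::complete_ultrametric_field"
  assumes "((\<lambda>x. absval (f x - l)) \<longlongrightarrow> 0) F"
  shows "(f \<longlongrightarrow> l) F"
  using assms by (subst tendsto_dist_iff) (simp only: uf_dist)

lemma uf_tendstoD:
  fixes l :: "'a::complete_ultrametric_field"
  assumes "(f \<longlongrightarrow> l) F"
  shows "((\<lambda>x. absval (f x - l)) \<longlongrightarrow> 0) F"
  using assms by (subst (asm) tendsto_dist_iff) (simp only: uf_dist)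

lemma uf_tendsto_add_Pair:
  fixes a b :: "'a::complete_ultrametric_field"
  shows "LIM x nhds a \<times>\<^sub>F nhds b. fst x + snd x :> nhds (a + b)"
proof (rule uf_tendstoI)
  let ?F = "nhds a \<times>\<^sub>F nhds b"
  have f: "((\<lambda>x. absval (fst x - a)) \<longlongrightarrow> 0) ?F"
    by (rule uf_tendstoD) (rule filterlim_fst)
  have s: "((\<lambda>x. absval (snd x - b)) \<longlongrightarrow> 0) ?F"
    by (rule uf_tendstoD) (rule filterlim_snd)
  have z: "((\<lambda>x. absval (fst x - a) + absval (snd x - b)) \<longlongrightarrow> 0) ?F"
    using tendsto_add[OF f s] by simp
  have le: "absval (fst x + snd x - (a + b)) \<le> absval (fst x - a) + absval (snd x - b)" for x
  proof -
    have "fst x + snd x - (a + b) = (fst x - a) + (snd x - b)"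
      by (simp add: algebra_simps)
    then have "absval (fst x + snd x - (a + b)) \<le> max (absval (fst x - a)) (absval (snd x - b))"
      using uf_absval_add by metis
    also have "\<dots> \<le> absval (fst x - a) + absval (snd x - b)"
      by simp
    finally show ?thesis .
  qed
  show "((\<lambda>x. absval (fst x + snd x - (a + b))) \<longlongrightarrow> 0) ?F"
    by (rule real_tendsto_sandwich[OF _ _ tendsto_const z])
      (rule always_eventually, rule allI, rule uf_absval_nonneg le)+
qed

lemma uf_tendsto_uminus:
  fixes a :: "'a::complete_ultrametric_field"
  shows "(uminus \<longlongrightarrow> - a) (nhds a)"
proof (rule uf_tendstoI)
  have eq: "absval (- x - - a) = absval (x - a)" for x
  proof -
    have "- x - - a = - (x - a)" by simp
    then show ?thesis by (simp only: uf_absval_minus)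
  qed
  show "((\<lambda>x. absval (- x - - a)) \<longlongrightarrow> 0) (nhds a)"
    by (subst eq, rule uf_tendstoD, rule filterlim_ident)
qed

instance complete_ultrametric_field \<subseteq> topological_ab_group_add
  by intro_classes (rule uf_tendsto_add_Pair uf_tendsto_uminus)+

subsection \<open>The residue field and its identification with a subfield\<close>

definition field_ring :: "'k::field ring" where
  "field_ring = \<lparr>carrier = UNIV, monoid.mult = (*), one = 1, ring.zero = 0, add = (+)\<rparr>"

definition valuation_ring :: "'k::complete_ultrametric_field ring" where
  "valuation_ring = field_ring\<lparr>carrier := {x. absval x \<le> 1}\<rparr>"

definition maximal_ideal :: "'k::complete_ultrametric_field set" where
  "maximal_ideal = {x. absval x < 1}"

definition residue_field :: "'k::complete_ultrametric_field set ring" where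
  "residue_field = valuation_ring Quot maximal_ideal"

text \<open>\<open>K\<close> is a copy of the residue field inside the field: a subfield contained in the valuation
  ring that reduction modulo the maximal ideal maps isomorphically onto the residue field
  (e.g. the constants in a field of formal Laurent series).\<close>

definition residue_subfield :: "'k::complete_ultrametric_field set \<Rightarrow> bool" where
  "residue_subfield K \<longleftrightarrow>
     subfield K field_ring \<and> K \<subseteq> carrier valuation_ring \<and>
     (\<lambda>x. maximal_ideal +>\<^bsub>valuation_ring\<^esub> x) \<in> ring_iso (field_ring\<lparr>carrier := K\<rparr>) residue_field"

section \<open>The space of vectors with the sup absval\<close>

definition sup_norm :: "'k::complete_ultrametric_field ^ 'm::finite \<Rightarrow> real" where
  "sup_norm x = Max (range (\<lambda>i. absval (x $ i)))"

definition B0 :: "'k::complete_ultrametric_field ^ 'm::finite \<Rightarrow> real \<Rightarrow> ('k ^ 'm) set" where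
  "B0 x \<rho> = {y. sup_norm (x - y) < \<rho>}"

text \<open>The library topology on vectors is the one given by the sup absval.\<close>

lemma open_vec_iff_B0:
  fixes S :: "('k::complete_ultrametric_field ^ 'm::finite) set"
  shows "open S \<longleftrightarrow> (\<forall>x\<in>S. \<exists>e>0. B0 x e \<subseteq> S)"
proof -
  have B: "y \<in> B0 x e \<longleftrightarrow> (\<forall>i. dist (x $ i) (y $ i) < e)" for x y :: "'k ^ 'm" and e
    by (simp add: B0_def sup_norm_def uf_dist)
  show ?thesis
  proof (intro iffI ballI)
    fix x assume "open S" "x \<in> S"
    then obtain e where e: "e > 0" "\<And>y. dist y x < e \<Longrightarrow> y \<in> S"
      by (auto simp: open_dist)
    define d where "d = e / real CARD('m)"
    have d: "d > 0" using e by (simp add: d_def)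
    have "B0 x d \<subseteq> S"
    proof
      fix y assume y: "y \<in> B0 x d"
      have "dist y x \<le> (\<Sum>i\<in>UNIV. dist (y $ i) (x $ i))"
        by (simp add: dist_vec_def L2_set_le_sum)
      also have "\<dots> < (\<Sum>i\<in>(UNIV::'m set). d)"
        using y by (intro sum_strict_mono) (auto simp: B dist_commute)
      also have "\<dots> = e" by (simp add: d_def)
      finally show "y \<in> S" by (rule e(2))
    qed
    with d show "\<exists>e>0. B0 x e \<subseteq> S" by blast
  next
    assume *: "\<forall>x\<in>S. \<exists>e>0. B0 x e \<subseteq> S"
    show "open S"
      unfolding open_dist
    proof
      fix x assume "x \<in> S"
      with * obtain e where e: "e > 0" "B0 x e \<subseteq> S" by blast
      have "y \<in> S" if "dist y x < e" for y
      proof -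
        have "dist (x $ i) (y $ i) < e" for i
          using dist_vec_nth_le[of x i y] that by (simp add: dist_commute)
        then show ?thesis using e(2) B by blast
      qed
      with e(1) show "\<exists>e>0. \<forall>y. dist y x < e \<longrightarrow> y \<in> S" by blast
    qed
  qed
qed

section \<open>Power series\<close>

text \<open>Multi-indices in \<open>n\<close> variables are functions \<open>'n \<Rightarrow> nat\<close>; a power series is its
  coefficient family.\<close>

definition ps_converges ::
  "(('n::finite \<Rightarrow> nat) \<Rightarrow> 'k::complete_ultrametric_field ^ 'm::finite) \<Rightarrow> real \<Rightarrow> bool" where
  "ps_converges F \<rho> \<longleftrightarrow> (\<lambda>\<alpha>. sup_norm (F \<alpha>) * \<rho> ^ (\<Sum>i\<in>UNIV. \<alpha> i)) summable_on UNIV"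

text \<open>Meaningful (bounded) whenever \<open>ps_converges F \<rho>\<close>.\<close>

definition ps_norm ::
  "(('n::finite \<Rightarrow> nat) \<Rightarrow> 'k::complete_ultrametric_field ^ 'm::finite) \<Rightarrow> real \<Rightarrow> real" where
  "ps_norm F \<rho> = (SUP \<alpha>. sup_norm (F \<alpha>) * \<rho> ^ (\<Sum>i\<in>UNIV. \<alpha> i))"

definition ps_eval ::
  "(('n::finite \<Rightarrow> nat) \<Rightarrow> 'k::complete_ultrametric_field) \<Rightarrow> 'k ^ 'n \<Rightarrow> 'k" where
  "ps_eval f x = (\<Sum>\<^sub>\<infinity>\<alpha>. f \<alpha> * (\<Prod>i\<in>UNIV. (x $ i) ^ \<alpha> i))"

definition ps_partial ::
  "'n \<Rightarrow> (('n::finite \<Rightarrow> nat) \<Rightarrow> 'k::complete_ultrametric_field) \<Rightarrow> ('n \<Rightarrow> nat) \<Rightarrow> 'k" where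
  "ps_partial i f = (\<lambda>\<alpha>. of_nat (Suc (\<alpha> i)) * f (\<alpha>(i := Suc (\<alpha> i))))"

text \<open>\<open>G i \<alpha> $ j\<close> is the coefficient of \<open>X\<^sup>\<alpha>\<close> in \<open>G\<^sub>i\<^sub>j\<close>.\<close>

definition mat_eval ::
  "('n::finite \<Rightarrow> ('n \<Rightarrow> nat) \<Rightarrow> 'k::complete_ultrametric_field ^ 'l::finite)
     \<Rightarrow> 'k ^ 'n \<Rightarrow> 'k ^ 'l ^ 'n" where
  "mat_eval G h = (\<chi> i j. ps_eval (\<lambda>\<alpha>. G i \<alpha> $ j) h)"

text \<open>\<open>mat_diff G w [v\<^sub>1, \<dots>, v\<^sub>t]\<close> is \<open>d\<^sup>tG(w)(v\<^sub>1, \<dots>, v\<^sub>t)\<close>; the list \<open>ls\<close> runs over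
  all tuples of directions \<open>(l\<^sub>1, \<dots>, l\<^sub>t)\<close>.\<close>

definition mat_diff ::
  "('n::finite \<Rightarrow> ('n \<Rightarrow> nat) \<Rightarrow> 'k::complete_ultrametric_field ^ 'l::finite)
     \<Rightarrow> 'k ^ 'n \<Rightarrow> ('k ^ 'n) list \<Rightarrow> 'k ^ 'l ^ 'n" where
  "mat_diff G w vs = (\<chi> i j. \<Sum>ls\<in>{ls :: 'n list. length ls = length vs}.
     ps_eval (foldr ps_partial ls (\<lambda>\<alpha>. G i \<alpha> $ j)) w * (\<Prod>s<length vs. (vs ! s) $ (ls ! s)))"

section \<open>Rooted trees and the tree expansion\<close>

datatype rtree = Node "rtree list"

fun nodes :: "rtree \<Rightarrow> nat" where
  "nodes (Node ts) = Suc (\<Sum>t\<leftarrow>ts. nodes t)"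

definition trees :: "nat \<Rightarrow> rtree set" where
  "trees N = {\<theta>. nodes \<theta> = N}"

lemma finite_trees: "finite (trees N)"
proof (induction N rule: less_induct)
  case (less N)
  define A where "A = (\<Union>m<N. trees m)"
  have fA: "finite A" using less by (auto simp: A_def)
  have pos: "0 < nodes t" for t by (cases t) simp
  have len: "length ts \<le> (\<Sum>t\<leftarrow>ts. nodes t)" for ts
  proof (induction ts)
    case (Cons t ts)
    then show ?case using pos[of t] by simp
  qed simp
  have "trees N \<subseteq> Node ` {ts. set ts \<subseteq> A \<and> length ts \<le> N}"
  proof
    fix \<theta> assume "\<theta> \<in> trees N"
    moreover obtain ts where ts: "\<theta> = Node ts" by (cases \<theta>)
    ultimately have N: "N = Suc (\<Sum>t\<leftarrow>ts. nodes t)" by (simp add: trees_def)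
    have "nodes t < N" if "t \<in> set ts" for t
      using member_le_sum_list[of "nodes t" "map nodes ts"] that N by simp
    then have "set ts \<subseteq> A" by (auto simp: A_def trees_def)
    moreover have "length ts \<le> N" using len[of ts] N by simp
    ultimately show "\<theta> \<in> Node ` {ts. set ts \<subseteq> A \<and> length ts \<le> N}" using ts by blast
  qed
  then show ?case
    by (rule finite_subset) (intro finite_imageI finite_lists_length_le fA)
qed

fun tree_val ::
  "('k::complete_ultrametric_field ^ 'n::finite \<Rightarrow> 'k ^ 'n)
     \<Rightarrow> ('n \<Rightarrow> ('n \<Rightarrow> nat) \<Rightarrow> 'k ^ 'l::finite) \<Rightarrow> rtree \<Rightarrow> 'k ^ 'l \<Rightarrow> 'k ^ 'n \<Rightarrow> 'k ^ 'n" where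
  "tree_val \<Lambda> G (Node ts) u w =
     (if ts = [] then \<Lambda> (mat_eval G (\<Lambda> w) *v u)
      else (1 / fact (length ts)) *s
             \<Lambda> (mat_diff G (\<Lambda> w) (map (\<lambda>\<theta>. tree_val \<Lambda> G \<theta> u w) ts) *v u))"

definition tree_level ::
  "('k::complete_ultrametric_field ^ 'n::finite \<Rightarrow> 'k ^ 'n)
     \<Rightarrow> ('n \<Rightarrow> ('n \<Rightarrow> nat) \<Rightarrow> 'k ^ 'l::finite) \<Rightarrow> 'k ^ 'l \<Rightarrow> 'k ^ 'n \<Rightarrow> nat \<Rightarrow> 'k ^ 'n" where
  "tree_level \<Lambda> G u w N = (\<Sum>\<theta>\<in>trees N. tree_val \<Lambda> G \<theta> u w)"

definition tree_solution ::
  "('k::complete_ultrametric_field ^ 'n::finite \<Rightarrow> 'k ^ 'n)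
     \<Rightarrow> ('n \<Rightarrow> ('n \<Rightarrow> nat) \<Rightarrow> 'k ^ 'l::finite) \<Rightarrow> 'k ^ 'l \<Rightarrow> 'k ^ 'n \<Rightarrow> 'k ^ 'n" where
  "tree_solution \<Lambda> G u w = \<Lambda> w + (\<Sum>N. tree_level \<Lambda> G u w (Suc N))"

end

theory Submission
  imports Defs "HOL-Computational_Algebra.Polynomial"
begin

text \<open>Put \<open>x = \<Lambda> w\<close> and look for the solution in the form \<open>h = x + v\<close>. The equation becomes
  \<open>v = \<Lambda> (G (x + v) u)\<close>, and Taylor's formula turns its right-hand side into
  \<open>\<Sum>\<^sub>t \<Lambda> (d\<^sup>tG(x)(v, \<dots>, v) u) / t!\<close>. If \<open>v\<close> is a sum of terms \<open>Val \<theta>\<close> over all trees, then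
  expanding the multilinear form \<open>d\<^sup>tG(x)\<close> produces one term for each list of \<open>t\<close> trees, and this
  term is by definition the value of the tree whose root carries that list. Since every tree
  consists of a root and the list of its subtrees in exactly one way, the sum over all lists is
  again the sum over all trees: \<open>v = \<Sum>\<^sub>\<theta> Val \<theta>\<close> solves the equation (\<open>tree_total_equation\<close>).

  Rearranging these sums is legitimate because everything tends to \<open>0\<close>. In a complete ultrametric
  field a family is summable, in any order, as soon as only finitely many members exceed any given
  size (\<open>vanishing_imp_summable\<close>). The bound needed is \<open>\<parallel>Val \<theta>\<parallel> \<le> r q\<^sup>N\<close> for trees with \<open>N\<close> nodes,
  where \<open>q = M \<parallel>u\<parallel> / r < 1\<close> (\<open>tree_val_bound\<close>); it follows by induction on the tree from Cauchy's
  estimate \<open>M / r\<^sup>t\<close> for the derivatives of order \<open>t\<close>, integers having absolute value at most \<open>1\<close>.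
  The factors \<open>1 / t!\<close> are harmless: the residue field embeds in \<open>k\<close>, so it has characteristic
  zero and \<open>|t!| = 1\<close> (\<open>residue_subfield_fact\<close>).

  Taylor's formula itself (\<open>taylor_expansion\<close>) is obtained by restricting \<open>f\<close> to the line
  \<open>z \<mapsto> x + z y\<close>, where each monomial becomes a polynomial in the single variable \<open>z\<close>. Summing its
  coefficients over the monomials gives the homogeneous parts of \<open>f (x + y)\<close>, and \<open>d/dz\<close> on these
  polynomials corresponds to the derivative in the direction \<open>y\<close> on \<open>f\<close>.

  Uniqueness and continuity come from one estimate (\<open>solution_perturbation\<close>): \<open>h \<mapsto> G(h) u\<close> has
  Lipschitz constant \<open>q < 1\<close>, so a solution depends on \<open>(u, w)\<close> in a Lipschitz way.\<close>

section \<open>Ultrametric summation\<close>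

lemma uf_absval_one [simp]: "absval (1 :: 'k::complete_ultrametric_field) = 1"
  using uf_absval_mult[of 1 "1::'k"] by simp

lemma uf_absval_diff:
  "absval (x - y :: 'k::complete_ultrametric_field) \<le> max (absval x) (absval y)"
  using uf_absval_add[of x "- y"] by simp

lemma uf_absval_of_nat: "absval (of_nat n :: 'k::complete_ultrametric_field) \<le> 1"
proof (induction n)
  case (Suc n)
  then show ?case using uf_absval_add[of 1 "of_nat n :: 'k"] by simp
qed simp

lemma uf_absval_power: "absval (x ^ n :: 'k::complete_ultrametric_field) = absval x ^ n"
  by (induction n) (simp_all add: uf_absval_mult)

lemma uf_absval_prod:
  "absval (prod f A :: 'k::complete_ultrametric_field) = (\<Prod>a\<in>A. absval (f a))"
  by (induction A rule: infinite_finite_induct) (simp_all add: uf_absval_mult)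

lemma uf_absval_sum_le:
  fixes f :: "'a \<Rightarrow> 'k::complete_ultrametric_field"
  assumes "\<And>a. a \<in> A \<Longrightarrow> absval (f a) \<le> c" and "0 \<le> c"
  shows "absval (sum f A) \<le> c"
  using assms
proof (induction A rule: infinite_finite_induct)
  case (insert a A)
  then show ?case
    using uf_absval_add[of "f a" "sum f A"] by force
qed simp_all

text \<open>With this instance the library's lemmas on multiplying infinite sums by constants and on
  continuity of products apply.\<close>

instance complete_ultrametric_field \<subseteq> topological_semigroup_mult
proof intro_classes
  fix a b :: 'a
  let ?F = "nhds a \<times>\<^sub>F nhds b"
  have f: "((\<lambda>x. absval (fst x - a)) \<longlongrightarrow> 0) ?F"
    by (rule uf_tendstoD) (rule filterlim_fst)
  have s: "((\<lambda>x. absval (snd x - b)) \<longlongrightarrow> 0) ?F"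
    by (rule uf_tendstoD) (rule filterlim_snd)
  have z: "((\<lambda>x. absval (fst x - a) * absval (snd x - b) + absval a * absval (snd x - b)
      + absval (fst x - a) * absval b) \<longlongrightarrow> 0) ?F"
    using f s by (auto intro!: tendsto_eq_intros)
  have le: "absval (fst x * snd x - a * b) \<le> absval (fst x - a) * absval (snd x - b)
      + absval a * absval (snd x - b) + absval (fst x - a) * absval b" for x
  proof -
    have "fst x * snd x - a * b = (fst x - a) * (snd x - b) + a * (snd x - b) + (fst x - a) * b"
      by (simp add: algebra_simps)
    also have "absval \<dots> \<le> max (max (absval ((fst x - a) * (snd x - b))) (absval (a * (snd x - b))))
         (absval ((fst x - a) * b))"
      by (rule order_trans[OF uf_absval_add max.mono[OF uf_absval_add order_refl]])
    also have "\<dots> \<le> absval ((fst x - a) * (snd x - b)) + absval (a * (snd x - b)) + absval ((fst x - a) * b)"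
      by simp
    finally show ?thesis by (simp only: uf_absval_mult)
  qed
  show "LIM x ?F. fst x * snd x :> nhds (a * b)"
    by (rule uf_tendstoI, rule real_tendsto_sandwich[OF _ _ tendsto_const z])
      (rule always_eventually, rule allI, rule uf_absval_nonneg le)+
qed

text \<open>Convergence to \<open>0\<close> along the cofinite filter of the index set; over a complete ultrametric
  field this is the natural criterion for unordered summability.\<close>

definition vanishing :: "('a \<Rightarrow> 'k::complete_ultrametric_field) \<Rightarrow> 'a set \<Rightarrow> bool" where
  "vanishing f A \<longleftrightarrow> (\<forall>\<epsilon>>0. finite {a \<in> A. \<epsilon> \<le> absval (f a)})"

text \<open>The finite partial sums form a Cauchy net: once a partial sum contains the finitely many
  terms of size at least \<open>\<epsilon>\<close>, adding further terms moves it by less than \<open>\<epsilon>\<close>, however many they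
  are.\<close>

lemma vanishing_imp_summable:
  fixes f :: "'a \<Rightarrow> 'k::complete_ultrametric_field"
  assumes "vanishing f A"
  shows "f summable_on A"
proof -
  have "cauchy_filter (filtermap (sum f) (finite_subsets_at_top A))"
    unfolding cauchy_filter_metric_filtermap
  proof (intro allI impI)
    fix e :: real assume e: "e > 0"
    define D where "D = {a \<in> A. e/2 \<le> absval (f a)}"
    have "e/2 > 0" using e by simp
    then have fD: "finite D" using assms unfolding D_def vanishing_def by blast
    define P where "P X \<longleftrightarrow> finite X \<and> D \<subseteq> X \<and> X \<subseteq> A" for X
    have "eventually P (finite_subsets_at_top A)"
      unfolding eventually_finite_subsets_at_top P_def using fD
      by (intro exI[of _ D]) (auto simp: D_def)
    moreover have "dist (sum f X) (sum f Y) < e" if "P X" "P Y" for X Y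
    proof -
      have rest: "absval (sum f (Z - D)) \<le> e/2" if "P Z" for Z
        using that e by (intro uf_absval_sum_le) (auto simp: P_def D_def)
      have split: "sum f Z = sum f (Z - D) + sum f D" if "P Z" for Z
        using that by (intro sum.subset_diff) (auto simp: P_def)
      have "absval (sum f X - sum f Y) = absval (sum f (X - D) - sum f (Y - D))"
        using split[OF that(1)] split[OF that(2)] by simp
      also have "\<dots> \<le> e/2"
        by (rule order_trans[OF uf_absval_diff max.boundedI[OF rest[OF that(1)] rest[OF that(2)]]])
      finally show ?thesis using e by (simp add: uf_dist)
    qed
    ultimately show "\<exists>P. eventually P (finite_subsets_at_top A) \<and>
        (\<forall>x y. P x \<and> P y \<longrightarrow> dist (sum f x) (sum f y) < e)"
      by blast
  qed
  then have "convergent_filter (filtermap (sum f) (finite_subsets_at_top A))"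
    by (rule cauchy_filter_convergent)
  then show ?thesis
    by (auto simp: convergent_filter_iff summable_on_def has_sum_def filterlim_def)
qed

text \<open>If \<open>c < |s|\<close> held for the sum \<open>s\<close>, a finite partial sum closer to \<open>s\<close> than \<open>|s| - c\<close> would
  also have absolute value above \<open>c\<close>. A family that is not summable has \<open>infsum\<close> equal to \<open>0\<close>,
  which satisfies the bound too.\<close>

lemma absval_infsum_le:
  fixes f :: "'a \<Rightarrow> 'k::complete_ultrametric_field"
  assumes "\<And>a. a \<in> A \<Longrightarrow> absval (f a) \<le> c" and "0 \<le> c"
  shows "absval (infsum f A) \<le> c"
proof (cases "f summable_on A")
  case True
  define s where "s = infsum f A"
  have s: "(f has_sum s) A" using True by (simp add: s_def)
  show ?thesis
  proof (rule ccontr)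
    assume "\<not> ?thesis"
    then have gt: "c < absval s" by (simp add: s_def)
    define e where "e = (absval s - c) / 2"
    have "e > 0" using gt by (simp add: e_def)
    from has_sum_finite_approximation[OF s this]
    obtain F where F: "F \<subseteq> A" "dist (sum f F) s \<le> e" by blast
    have "absval (sum f F) \<le> c" using F assms by (intro uf_absval_sum_le) auto
    moreover have "absval s \<le> max (absval (sum f F)) (absval (sum f F - s))"
      using uf_absval_diff[of "sum f F" "sum f F - s"] by simp
    ultimately show False using F gt assms(2) by (auto simp: uf_dist e_def)
  qed
qed (use assms in \<open>simp add: infsum_not_exists\<close>)

text \<open>The form in which vanishing is verified below: by geometric decay in a grading with finite
  levels (the degree of a multi-index, the number of nodes of a tree).\<close>

lemma vanishing_geometric:
  fixes f :: "'a \<Rightarrow> 'k::complete_ultrametric_field" and d :: "'a \<Rightarrow> nat"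
  assumes fin: "\<And>n. finite {a \<in> A. d a = n}"
    and le: "\<And>a. a \<in> A \<Longrightarrow> absval (f a) \<le> c * q ^ (d a)" and q: "0 \<le> q" "q < 1"
  shows "vanishing f A"
  unfolding vanishing_def
proof (intro allI impI)
  fix e :: real assume e: "e > 0"
  have "(\<lambda>n. c * q ^ n) \<longlonglongrightarrow> 0"
    using LIMSEQ_power_zero[of q] q by (auto intro!: tendsto_eq_intros)
  then obtain N where N: "\<And>n. n \<ge> N \<Longrightarrow> c * q ^ n < e"
    using order_tendstoD(2)[of "\<lambda>n. c * q ^ n" 0 sequentially e] e
    unfolding eventually_sequentially by auto
  have "{a \<in> A. e \<le> absval (f a)} \<subseteq> (\<Union>n<N. {a \<in> A. d a = n})"
  proof
    fix a assume a: "a \<in> {a \<in> A. e \<le> absval (f a)}"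
    then have "e \<le> c * q ^ d a" using le[of a] by simp
    then have "d a < N" using N[of "d a"] by (meson not_le)
    then show "a \<in> (\<Union>n<N. {a \<in> A. d a = n})" using a by blast
  qed
  then show "finite {a \<in> A. e \<le> absval (f a)}"
    by (rule finite_subset) (use fin in auto)
qed

lemma vanishing_bounded:
  assumes "vanishing f A"
  obtains B where "B > 0" "\<And>a. a \<in> A \<Longrightarrow> absval (f a) \<le> B"
proof -
  define D where "D = {a \<in> A. 1 \<le> absval (f a)}"
  have fin: "finite D" using assms by (simp add: D_def vanishing_def)
  define B where "B = Max (insert 1 ((\<lambda>a. absval (f a)) ` D))"
  have "absval (f a) \<le> B" if "a \<in> A" for a
  proof (cases "a \<in> D")
    case True then show ?thesis unfolding B_def using fin by (intro Max_ge) auto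
  next
    case False
    then have "absval (f a) \<le> 1" using that by (auto simp: D_def)
    also have "1 \<le> B" unfolding B_def using fin by (intro Max_ge) auto
    finally show ?thesis .
  qed
  moreover have "0 < B"
    using fin by (auto simp: B_def Max_gr_iff)
  ultimately show ?thesis using that by blast
qed

text \<open>Both factors are bounded, so a large product forces both of its factors to be large.\<close>

lemma vanishing_product:
  fixes f :: "'a \<Rightarrow> 'k::complete_ultrametric_field"
  assumes f: "vanishing f A" and g: "vanishing g B"
  shows "vanishing (\<lambda>(a, b). f a * g b) (A \<times> B)"
proof -
  obtain F where F: "F > 0" "\<And>a. a \<in> A \<Longrightarrow> absval (f a) \<le> F"
    using vanishing_bounded[OF f] by blast
  obtain G where G: "G > 0" "\<And>b. b \<in> B \<Longrightarrow> absval (g b) \<le> G"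
    using vanishing_bounded[OF g] by blast
  show ?thesis
    unfolding vanishing_def
  proof (intro allI impI)
    fix e :: real assume e: "e > 0"
    have "e/G \<le> absval (f a) \<and> e/F \<le> absval (g b)"
      if "a \<in> A" "b \<in> B" "e \<le> absval (f a) * absval (g b)" for a b
    proof -
      have "absval (f a) * absval (g b) \<le> absval (f a) * G" "absval (f a) * absval (g b) \<le> F * absval (g b)"
        using that F G by (auto intro: mult_left_mono mult_right_mono)
      then show ?thesis using that F(1) G(1) by (simp add: field_simps)
    qed
    then have "{p \<in> A \<times> B. e \<le> absval (case p of (a, b) \<Rightarrow> f a * g b)}
        \<subseteq> {a \<in> A. e/G \<le> absval (f a)} \<times> {b \<in> B. e/F \<le> absval (g b)}"
      by (auto simp: uf_absval_mult)
    moreover have "finite {a \<in> A. e/G \<le> absval (f a)}" "finite {b \<in> B. e/F \<le> absval (g b)}"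
      using f g e F(1) G(1) by (simp_all add: vanishing_def)
    ultimately show "finite {p \<in> A \<times> B. e \<le> absval (case p of (a, b) \<Rightarrow> f a * g b)}"
      by (meson finite_SigmaI finite_subset)
  qed
qed

lemma has_sum_product:
  fixes f :: "'a \<Rightarrow> 'k::complete_ultrametric_field"
  assumes f: "vanishing f A" and g: "vanishing g B"
  shows "((\<lambda>(a, b). f a * g b) has_sum (infsum f A * infsum g B)) (A \<times> B)"
proof (rule has_sum_SigmaI)
  show "((\<lambda>b. case (a, b) of (a, b) \<Rightarrow> f a * g b) has_sum f a * infsum g B) B" for a
    using has_sum_cmult_right[OF has_sum_infsum[OF vanishing_imp_summable[OF g]]] by simp
  show "((\<lambda>a. f a * infsum g B) has_sum infsum f A * infsum g B) A"
    using has_sum_cmult_left[OF has_sum_infsum[OF vanishing_imp_summable[OF f]]] by simp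
qed (intro vanishing_imp_summable vanishing_product f g)

lemma has_sum_sum:
  fixes f :: "'i \<Rightarrow> 'a \<Rightarrow> 'k::complete_ultrametric_field"
  assumes "\<And>i. i \<in> I \<Longrightarrow> (f i has_sum s i) A"
  shows "((\<lambda>a. \<Sum>i\<in>I. f i a) has_sum (\<Sum>i\<in>I. s i)) A"
  using assms by (induction I rule: infinite_finite_induct) (simp_all add: has_sum_add)

section \<open>The Taylor expansion of a power series\<close>

abbreviation mdeg :: "('n::finite \<Rightarrow> nat) \<Rightarrow> nat" where
  "mdeg \<alpha> \<equiv> \<Sum>i\<in>UNIV. \<alpha> i"

lemma finite_mdeg: "finite {\<alpha> :: 'n::finite \<Rightarrow> nat. mdeg \<alpha> = d}"
proof -
  have "{\<alpha> :: 'n \<Rightarrow> nat. mdeg \<alpha> = d} \<subseteq> (UNIV \<rightarrow>\<^sub>E {..d})"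
    by (auto intro: member_le_sum)
  then show ?thesis by (rule finite_subset) (intro finite_PiE, auto)
qed

lemma mdeg_upd: "mdeg (\<alpha>(i := k)) + \<alpha> i = mdeg \<alpha> + k" for \<alpha> :: "'n::finite \<Rightarrow> nat"
  by (simp add: sum.remove[of UNIV i])

text \<open>A bound on the coefficients with the weights \<open>r\<^bsup>|\<alpha>|\<^esup>\<close>, i.e. \<open>\<parallel>f\<parallel>\<^sub>r \<le> C\<close>. Inside the open
  polydisc of radius \<open>r\<close> it makes the terms of the series decay geometrically.\<close>

definition ps_bounded ::
  "real \<Rightarrow> real \<Rightarrow> (('n::finite \<Rightarrow> nat) \<Rightarrow> 'k::complete_ultrametric_field) \<Rightarrow> bool" where
  "ps_bounded r C f \<longleftrightarrow> (\<forall>\<alpha>. absval (f \<alpha>) * r ^ mdeg \<alpha> \<le> C)"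

lemma ps_bounded_nonneg: "ps_bounded r C f \<Longrightarrow> 0 < r \<Longrightarrow> 0 \<le> C"
  unfolding ps_bounded_def by (meson less_eq_real_def mult_nonneg_nonneg order_trans uf_absval_nonneg zero_le_power)

text \<open>Differentiation costs a factor \<open>1/r\<close>, the integer factors \<open>\<alpha>\<^sub>i + 1\<close> being of absolute value
  at most \<open>1\<close>.\<close>

lemma ps_bounded_partial:
  assumes f: "ps_bounded r C f" and r: "0 < r"
  shows "ps_bounded r (C / r) (ps_partial i f)"
  unfolding ps_bounded_def
proof
  fix \<alpha>
  have "absval (ps_partial i f \<alpha>) \<le> absval (f (\<alpha>(i := Suc (\<alpha> i))))"
    unfolding ps_partial_def uf_absval_mult
    using mult_right_mono[OF uf_absval_of_nat[of "Suc (\<alpha> i)"] uf_absval_nonneg]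
    by (metis mult_1)
  then have "absval (ps_partial i f \<alpha>) * r ^ mdeg \<alpha> * r
      \<le> absval (f (\<alpha>(i := Suc (\<alpha> i)))) * r ^ mdeg \<alpha> * r"
    using r by (intro mult_right_mono) auto
  also have "\<dots> = absval (f (\<alpha>(i := Suc (\<alpha> i)))) * r ^ mdeg (\<alpha>(i := Suc (\<alpha> i)))"
  proof -
    have "mdeg (\<alpha>(i := Suc (\<alpha> i))) = Suc (mdeg \<alpha>)" using mdeg_upd[of \<alpha> i "Suc (\<alpha> i)"] by simp
    then show ?thesis by simp
  qed
  also have "\<dots> \<le> C" using f by (simp only: ps_bounded_def)
  finally show "absval (ps_partial i f \<alpha>) * r ^ mdeg \<alpha> \<le> C / r"
    using r by (simp add: field_simps)
qed

lemma ps_bounded_partials: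
  assumes "ps_bounded r C f" and "0 < r"
  shows "ps_bounded r (C / r ^ length ls) (foldr ps_partial ls f)"
proof (induction ls)
  case (Cons l ls)
  then show ?case using ps_bounded_partial[OF Cons assms(2), of l] by (simp add: mult.commute)
qed (use assms in simp)

text \<open>The polynomial \<open>(x + z y)\<^sup>\<gamma>\<close> in the single variable \<open>z\<close>; its coefficients are the
  homogeneous parts, in \<open>y\<close>, of \<open>(x + y)\<^sup>\<gamma>\<close>.\<close>

definition line_poly :: "'k::complete_ultrametric_field ^ 'n::finite \<Rightarrow> 'k ^ 'n \<Rightarrow> ('n \<Rightarrow> nat) \<Rightarrow> 'k poly" where
  "line_poly x y \<gamma> = (\<Prod>i\<in>UNIV. [:x $ i, y $ i:] ^ \<gamma> i)"

text \<open>Multiplicativity of the Gauss norm: polynomials whose \<open>t\<close>-th coefficients are bounded by a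
  multiple of \<open>\<tau>\<^sup>t\<close> have products of the same kind, with the product of the two constants.\<close>

lemma coeff_mult_bound:
  fixes p q :: "'k::complete_ultrametric_field poly"
  assumes p: "\<And>t. absval (Polynomial.coeff p t) \<le> a * \<tau> ^ t" and q: "\<And>t. absval (Polynomial.coeff q t) \<le> b * \<tau> ^ t"
    and "0 \<le> a" "0 \<le> b" "0 \<le> \<tau>"
  shows "absval (Polynomial.coeff (p * q) t) \<le> (a * b) * \<tau> ^ t"
  unfolding coeff_mult
proof (rule uf_absval_sum_le)
  fix i assume i: "i \<in> {..t}"
  have "absval (Polynomial.coeff p i * Polynomial.coeff q (t - i)) \<le> (a * \<tau> ^ i) * (b * \<tau> ^ (t - i))"
    unfolding uf_absval_mult using assms by (intro mult_mono) auto
  also have "\<dots> = (a * b) * \<tau> ^ t"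
    using i by (simp add: power_add[symmetric] mult.assoc mult.left_commute)
  finally show "absval (Polynomial.coeff p i * Polynomial.coeff q (t - i)) \<le> (a * b) * \<tau> ^ t" .
qed (use assms in auto)

lemma coeff_power_bound:
  fixes p :: "'k::complete_ultrametric_field poly"
  assumes p: "\<And>t. absval (Polynomial.coeff p t) \<le> a * \<tau> ^ t" and "0 \<le> a" "0 \<le> \<tau>"
  shows "absval (Polynomial.coeff (p ^ n) t) \<le> a ^ n * \<tau> ^ t"
proof (induction n arbitrary: t)
  case (Suc n)
  show ?case unfolding power_Suc by (intro coeff_mult_bound p Suc) (use assms in auto)
qed (use assms in \<open>auto simp: coeff_1\<close>)

lemma coeff_line_poly_bound:
  fixes x y :: "'k::complete_ultrametric_field ^ 'n::finite"
  assumes x: "\<And>i. absval (x $ i) \<le> \<sigma>" and y: "\<And>i. absval (y $ i) \<le> \<sigma> * \<tau>" and "0 \<le> \<sigma>" "0 \<le> \<tau>"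
  shows "absval (Polynomial.coeff (line_poly x y \<gamma>) t) \<le> \<sigma> ^ mdeg \<gamma> * \<tau> ^ t"
proof -
  have "absval (Polynomial.coeff (\<Prod>i\<in>I. [:x $ i, y $ i:] ^ \<gamma> i) t) \<le> \<sigma> ^ (\<Sum>i\<in>I. \<gamma> i) * \<tau> ^ t"
    if "finite I" for I t
    using that
  proof (induction I arbitrary: t)
    case (insert i I)
    have "absval (Polynomial.coeff [:x $ i, y $ i:] t) \<le> \<sigma> * \<tau> ^ t" for t
      using assms by (auto simp: coeff_pCons split: nat.split)
    then show ?case
      using insert assms
      by (simp add: power_add) (intro coeff_mult_bound coeff_power_bound, auto)
  qed (use assms in \<open>auto simp: coeff_1\<close>)
  from this[of UNIV] show ?thesis by (simp add: line_poly_def)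
qed

lemma poly_line_poly: "poly (line_poly x y \<gamma>) s = (\<Prod>i\<in>UNIV. (x $ i + s * y $ i) ^ \<gamma> i)"
  by (simp add: line_poly_def poly_prod)

lemma degree_line_poly: "Polynomial.degree (line_poly x y \<gamma>) \<le> mdeg \<gamma>"
proof -
  have "Polynomial.degree (line_poly x y \<gamma>) \<le> (\<Sum>i\<in>UNIV. Polynomial.degree ([:x $ i, y $ i:] ^ \<gamma> i))"
    unfolding line_poly_def using degree_prod_sum_le[of UNIV "\<lambda>i. [:x $ i, y $ i:] ^ \<gamma> i"] by simp
  also have "\<dots> \<le> mdeg \<gamma>"
  proof (rule sum_mono)
    fix i
    have "Polynomial.degree ([:x $ i, y $ i:] ^ \<gamma> i) \<le> Polynomial.degree [:x $ i, y $ i:] * \<gamma> i" by (rule degree_power_le)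
    also have "\<dots> \<le> \<gamma> i" by simp
    finally show "Polynomial.degree ([:x $ i, y $ i:] ^ \<gamma> i) \<le> \<gamma> i" .
  qed
  finally show ?thesis .
qed

lemma pderiv_line_poly:
  "pderiv (line_poly x y \<gamma>) = (\<Sum>l\<in>UNIV. Polynomial.smult (of_nat (\<gamma> l) * y $ l) (line_poly x y (\<gamma>(l := \<gamma> l - 1))))"
proof -
  have "(\<Prod>i\<in>UNIV - {l}. [:x $ i, y $ i:] ^ \<gamma> i) * pderiv ([:x $ l, y $ l:] ^ \<gamma> l)
      = Polynomial.smult (of_nat (\<gamma> l) * y $ l) (line_poly x y (\<gamma>(l := \<gamma> l - 1)))" for l
  proof -
    have "line_poly x y (\<gamma>(l := \<gamma> l - 1))
        = [:x $ l, y $ l:] ^ (\<gamma> l - 1) * (\<Prod>i\<in>UNIV - {l}. [:x $ i, y $ i:] ^ \<gamma> i)"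
      unfolding line_poly_def by (subst prod.remove[of UNIV l]) auto
    moreover have "pderiv [:x $ l, y $ l:] = [:y $ l:]" by (simp add: pderiv_pCons)
    ultimately show ?thesis by (simp add: pderiv_power mult.commute)
  qed
  then show ?thesis by (simp add: line_poly_def[of x y \<gamma>] pderiv_prod)
qed

text \<open>The homogeneous part of degree \<open>s\<close> in \<open>y\<close> of \<open>f (x + y)\<close>.\<close>

definition taylor_part :: "'k::complete_ultrametric_field ^ 'n::finite \<Rightarrow> 'k ^ 'n \<Rightarrow> nat
    \<Rightarrow> (('n \<Rightarrow> nat) \<Rightarrow> 'k) \<Rightarrow> 'k" where
  "taylor_part x y s f = (\<Sum>\<^sub>\<infinity>\<gamma>. f \<gamma> * Polynomial.coeff (line_poly x y \<gamma>) s)"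

lemma taylor_part_0: "taylor_part x y 0 f = ps_eval f x"
  by (simp add: taylor_part_def ps_eval_def poly_0_coeff_0[symmetric] poly_line_poly)


text \<open>The common source of convergence for \<open>f\<close> itself (with \<open>c\<close> the monomials evaluated at a
  point) and for its homogeneous parts (with \<open>c\<close> the coefficients of the polynomials
  \<open>(x + z y)\<^sup>\<gamma>\<close>).\<close>

lemma vanishing_weighted:
  fixes c :: "('n::finite \<Rightarrow> nat) \<Rightarrow> 'k::complete_ultrametric_field"
  assumes f: "ps_bounded r C f" and \<sigma>: "0 < \<sigma>" "\<sigma> < r" and c: "\<And>\<gamma>. absval (c \<gamma>) \<le> \<sigma> ^ mdeg \<gamma>"
  shows "vanishing (\<lambda>\<gamma>. f \<gamma> * c \<gamma>) UNIV"
    and "absval (f \<gamma> * c \<gamma>) \<le> C * (\<sigma> / r) ^ mdeg \<gamma>"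
proof -
  have *: "absval (f \<gamma> * c \<gamma>) \<le> C * (\<sigma> / r) ^ mdeg \<gamma>" for \<gamma>
  proof -
    have "absval (f \<gamma> * c \<gamma>) \<le> absval (f \<gamma>) * \<sigma> ^ mdeg \<gamma>"
      unfolding uf_absval_mult by (intro mult_left_mono c) simp
    also have "\<dots> = (absval (f \<gamma>) * r ^ mdeg \<gamma>) * (\<sigma> / r) ^ mdeg \<gamma>"
      using \<sigma> by (simp add: power_divide)
    also have "\<dots> \<le> C * (\<sigma> / r) ^ mdeg \<gamma>"
      using f \<sigma> unfolding ps_bounded_def by (intro mult_right_mono) auto
    finally show ?thesis .
  qed
  then show "absval (f \<gamma> * c \<gamma>) \<le> C * (\<sigma> / r) ^ mdeg \<gamma>" .
  show "vanishing (\<lambda>\<gamma>. f \<gamma> * c \<gamma>) UNIV"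
    by (rule vanishing_geometric[where d = mdeg, OF _ *]) (use \<sigma> in \<open>auto simp: finite_mdeg\<close>)
qed

lemma absval_monomial_le:
  fixes x :: "'k::complete_ultrametric_field ^ 'n::finite"
  assumes "\<And>i. absval (x $ i) \<le> \<sigma>"
  shows "absval (\<Prod>i\<in>UNIV. (x $ i) ^ \<gamma> i) \<le> \<sigma> ^ mdeg \<gamma>"
  unfolding uf_absval_prod uf_absval_power power_sum
  by (intro prod_mono conjI power_mono assms) auto

lemma has_sum_ps_eval:
  fixes x :: "'k::complete_ultrametric_field ^ 'n::finite"
  assumes "ps_bounded r C f" "0 < \<sigma>" "\<sigma> < r" "\<And>i. absval (x $ i) \<le> \<sigma>"
  shows "((\<lambda>\<gamma>. f \<gamma> * (\<Prod>i\<in>UNIV. (x $ i) ^ \<gamma> i)) has_sum ps_eval f x) UNIV"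
  unfolding ps_eval_def
  by (intro has_sum_infsum vanishing_imp_summable vanishing_weighted(1)[OF assms(1-3)]
      absval_monomial_le assms(4))

text \<open>An ultrametric sum is no larger than its largest term.\<close>

lemma ps_eval_bound:
  fixes x :: "'k::complete_ultrametric_field ^ 'n::finite"
  assumes f: "ps_bounded r C f" and r: "0 < r" and x: "\<And>i. absval (x $ i) \<le> r"
  shows "absval (ps_eval f x) \<le> C"
  unfolding ps_eval_def
proof (rule absval_infsum_le)
  fix \<gamma>
  have "absval (f \<gamma> * (\<Prod>i\<in>UNIV. (x $ i) ^ \<gamma> i)) \<le> absval (f \<gamma>) * r ^ mdeg \<gamma>"
    unfolding uf_absval_mult by (intro mult_left_mono absval_monomial_le x) simp
  also have "\<dots> \<le> C" using f by (simp add: ps_bounded_def)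
  finally show "absval (f \<gamma> * (\<Prod>i\<in>UNIV. (x $ i) ^ \<gamma> i)) \<le> C" .
qed (rule ps_bounded_nonneg[OF f r])

lemma has_sum_taylor_part:
  fixes x y :: "'k::complete_ultrametric_field ^ 'n::finite"
  assumes f: "ps_bounded r C f" and \<sigma>: "0 < \<sigma>" "\<sigma> < r"
    and x: "\<And>i. absval (x $ i) \<le> \<sigma>" and y: "\<And>i. absval (y $ i) \<le> \<sigma>"
  shows "((\<lambda>\<gamma>. f \<gamma> * Polynomial.coeff (line_poly x y \<gamma>) s) has_sum taylor_part x y s f) UNIV"
  unfolding taylor_part_def
proof (intro has_sum_infsum vanishing_imp_summable vanishing_weighted(1)[OF f \<sigma>])
  show "absval (Polynomial.coeff (line_poly x y \<gamma>) s) \<le> \<sigma> ^ mdeg \<gamma>" for \<gamma>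
    using coeff_line_poly_bound[of x \<sigma> y 1 \<gamma> s] x y \<sigma> by simp
qed

text \<open>\<open>f (x + y)\<close> is the sum of its homogeneous parts: both sides sum the family
  \<open>f\<^sub>\<gamma> [z\<^sup>t] (x + z y)\<^sup>\<gamma>\<close> over all pairs \<open>(\<gamma>, t)\<close>, in the two possible orders.\<close>

lemma has_sum_taylor_parts:
  fixes x y :: "'k::complete_ultrametric_field ^ 'n::finite"
  assumes f: "ps_bounded r C f" and \<sigma>: "0 < \<sigma>" "\<sigma> < r"
    and x: "\<And>i. absval (x $ i) \<le> \<sigma>" and y: "\<And>i. absval (y $ i) \<le> \<sigma>"
  shows "((\<lambda>t. taylor_part x y t f) has_sum ps_eval f (x + y)) UNIV"
proof -
  let ?c = "\<lambda>\<gamma> t. Polynomial.coeff (line_poly x y \<gamma>) t"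
  define F where "F = (\<lambda>(\<gamma>, t). f \<gamma> * ?c \<gamma> t)"
  have c: "absval (?c \<gamma> s) \<le> \<sigma> ^ mdeg \<gamma>" for \<gamma> s
    using coeff_line_poly_bound[of x \<sigma> y 1 \<gamma> s] x y \<sigma> by simp
  define S where "S = Sigma UNIV (\<lambda>\<gamma> :: 'n \<Rightarrow> nat. {..mdeg \<gamma>})"
  have "vanishing F S"
  proof (rule vanishing_geometric[where d = "mdeg \<circ> fst"])
    fix d
    have "{p \<in> S. (mdeg \<circ> fst) p = d} \<subseteq> {\<gamma>. mdeg \<gamma> = d} \<times> {..d}" by (auto simp: S_def)
    then show "finite {p \<in> S. (mdeg \<circ> fst) p = d}"
      by (rule finite_subset) (simp add: finite_mdeg)
  next
    fix p show "absval (F p) \<le> C * (\<sigma> / r) ^ (mdeg \<circ> fst) p"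
      using vanishing_weighted(2)[OF f \<sigma>, of "\<lambda>\<gamma>. ?c \<gamma> (snd p)" "fst p"] c by (simp add: F_def split_def)
  qed (use \<sigma> in auto)
  then have sm: "F summable_on S" by (rule vanishing_imp_summable)
  have row: "((\<lambda>t. F (\<gamma>, t)) has_sum f \<gamma> * (\<Prod>i\<in>UNIV. ((x + y) $ i) ^ \<gamma> i)) {..mdeg \<gamma>}" for \<gamma>
  proof (rule has_sum_finiteI)
    have "(\<Prod>i\<in>UNIV. ((x + y) $ i) ^ \<gamma> i) = poly (line_poly x y \<gamma>) 1"
      by (simp add: poly_line_poly)
    also have "\<dots> = (\<Sum>t\<le>mdeg \<gamma>. ?c \<gamma> t)"
      unfolding poly_altdef using degree_line_poly[of x y \<gamma>]
      by (auto intro!: sum.mono_neutral_left intro: le_degree)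
    finally show "f \<gamma> * (\<Prod>i\<in>UNIV. ((x + y) $ i) ^ \<gamma> i) = (\<Sum>t\<le>mdeg \<gamma>. F (\<gamma>, t))"
      by (simp add: F_def sum_distrib_left)
  qed simp
  have "(F has_sum ps_eval f (x + y)) S"
    unfolding S_def
  proof (rule has_sum_SigmaI[OF row])
    have "absval ((x + y) $ i) \<le> \<sigma>" for i
      using uf_absval_add[of "x $ i" "y $ i"] x[of i] y[of i] by simp
    then show "((\<lambda>\<gamma>. f \<gamma> * (\<Prod>i\<in>UNIV. ((x + y) $ i) ^ \<gamma> i)) has_sum ps_eval f (x + y)) UNIV"
      by (rule has_sum_ps_eval[OF f \<sigma>])
  qed (use sm in \<open>simp add: S_def\<close>)
  also have "(F has_sum ps_eval f (x + y)) S \<longleftrightarrow> (F has_sum ps_eval f (x + y)) (UNIV \<times> UNIV)"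
  proof (rule has_sum_cong_neutral)
    fix p assume "p \<in> UNIV \<times> UNIV - S"
    then have "Polynomial.degree (line_poly x y (fst p)) < snd p"
      using degree_line_poly[of x y "fst p"] by (cases p) (auto simp: S_def)
    then show "F p = 0" by (simp add: F_def split_def coeff_eq_0)
  qed (auto simp: S_def)
  also have "\<dots> \<longleftrightarrow> ((\<lambda>(t, \<gamma>). F (\<gamma>, t)) has_sum ps_eval f (x + y)) (UNIV \<times> UNIV)"
    by (rule has_sum_reindex_bij_witness[where i = prod.swap and j = prod.swap]) auto
  finally show ?thesis
    by (rule has_sum_SigmaD) (simp add: F_def has_sum_taylor_part[OF f \<sigma> x y])
qed

lemma sum_lists_Suc:
  fixes g :: "'n::finite list \<Rightarrow> 'a::comm_monoid_add"
  shows "(\<Sum>ls\<in>{ls. length ls = Suc t}. g ls) = (\<Sum>ls\<in>{ls. length ls = t}. \<Sum>l\<in>UNIV. g (l # ls))"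
proof -
  have fin: "finite {ls :: 'n list. length ls = t}"
    using finite_lists_length_eq[of "UNIV :: 'n set" t] by simp
  have "(\<Sum>ls\<in>{ls. length ls = Suc t}. g ls) = (\<Sum>(ls, l)\<in>{ls. length ls = t} \<times> UNIV. g (l # ls))"
    by (rule sum.reindex_bij_witness[where j = "\<lambda>ls. (tl ls, hd ls)" and i = "\<lambda>(ls, l). l # ls"])
       (auto simp: length_Suc_conv)
  then show ?thesis using fin by (simp add: sum.cartesian_product)
qed

text \<open>The derivative of \<open>f\<close> in the direction \<open>y\<close>, at \<open>x + z y\<close>, is the derivative of \<open>f (x + z y)\<close>
  with respect to \<open>z\<close>, and \<open>d/dz\<close> turns the coefficient of \<open>z\<^sup>s\<^sup>+\<^sup>1\<close> into \<open>s + 1\<close> times itself.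
  Termwise this is the product rule for the polynomials \<open>(x + z y)\<^sup>\<gamma>\<close>, after shifting the
  multi-index.\<close>

lemma taylor_part_partial:
  fixes x y :: "'k::complete_ultrametric_field ^ 'n::finite"
  assumes f: "ps_bounded r C f" and \<sigma>: "0 < \<sigma>" "\<sigma> < r"
    and x: "\<And>i. absval (x $ i) \<le> \<sigma>" and y: "\<And>i. absval (y $ i) \<le> \<sigma>"
  shows "(\<Sum>l\<in>UNIV. taylor_part x y s (ps_partial l f) * y $ l) = of_nat (Suc s) * taylor_part x y (Suc s) f"
proof -
  let ?c = "\<lambda>\<gamma> t. Polynomial.coeff (line_poly x y \<gamma>) t"
  have "((\<lambda>\<gamma>. f \<gamma> * (of_nat (\<gamma> l) * y $ l * ?c (\<gamma>(l := \<gamma> l - 1)) s)) has_sum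
      taylor_part x y s (ps_partial l f) * y $ l) UNIV" (is "(?g has_sum ?S) _") for l
  proof -
    have "((\<lambda>\<gamma>. ps_partial l f \<gamma> * ?c \<gamma> s * y $ l) has_sum ?S) UNIV"
      by (intro has_sum_cmult_left has_sum_taylor_part[OF ps_bounded_partial[OF f] \<sigma> x y]) (use \<sigma> in auto)
    (* the shift raises the l-th exponent, so it misses the multi-indices with exponent 0;
       there the terms of ?g vanish *)
    also have "?this \<longleftrightarrow> (?g has_sum ?S) {\<gamma>. \<gamma> l \<noteq> 0}"
      by (rule has_sum_reindex_bij_witness[where j = "\<lambda>\<gamma>. \<gamma>(l := Suc (\<gamma> l))" and i = "\<lambda>\<gamma>. \<gamma>(l := \<gamma> l - 1)"])
         (auto simp: ps_partial_def algebra_simps)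
    also have "\<dots> \<longleftrightarrow> (?g has_sum ?S) UNIV"
      by (rule has_sum_cong_neutral) auto
    finally show ?thesis .
  qed
  then have "((\<lambda>\<gamma>. \<Sum>l\<in>UNIV. f \<gamma> * (of_nat (\<gamma> l) * y $ l * ?c (\<gamma>(l := \<gamma> l - 1)) s)) has_sum
      (\<Sum>l\<in>UNIV. taylor_part x y s (ps_partial l f) * y $ l)) UNIV"
    by (rule has_sum_sum)
  moreover have "(\<Sum>l\<in>UNIV. f \<gamma> * (of_nat (\<gamma> l) * y $ l * ?c (\<gamma>(l := \<gamma> l - 1)) s))
      = of_nat (Suc s) * (f \<gamma> * ?c \<gamma> (Suc s))" for \<gamma>
  proof -
    have "(\<Sum>l\<in>UNIV. of_nat (\<gamma> l) * y $ l * ?c (\<gamma>(l := \<gamma> l - 1)) s)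
        = Polynomial.coeff (pderiv (line_poly x y \<gamma>)) s"
      unfolding pderiv_line_poly coeff_sum by simp
    also have "\<dots> = of_nat (Suc s) * ?c \<gamma> (Suc s)" by (rule coeff_pderiv)
    finally show ?thesis by (simp only: sum_distrib_left[symmetric] mult.left_commute)
  qed
  ultimately have "((\<lambda>\<gamma>. of_nat (Suc s) * (f \<gamma> * ?c \<gamma> (Suc s))) has_sum
      (\<Sum>l\<in>UNIV. taylor_part x y s (ps_partial l f) * y $ l)) UNIV"
    by simp
  moreover have "((\<lambda>\<gamma>. of_nat (Suc s) * (f \<gamma> * ?c \<gamma> (Suc s))) has_sum
      of_nat (Suc s) * taylor_part x y (Suc s) f) UNIV"
    by (intro has_sum_cmult_right has_sum_taylor_part[OF f \<sigma> x y])
  ultimately show ?thesis by (rule has_sum_unique)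
qed

text \<open>Each differentiation raises the degree by one and contributes the factor \<open>s + 1\<close>; the
  factors accumulate to \<open>(s + t)! / s!\<close>. At \<open>s = 0\<close>, where the homogeneous part is the value at
  \<open>x\<close>, this is the Taylor coefficient; the induction needs all \<open>s\<close>.\<close>

lemma taylor_part_iterated:
  fixes x y :: "'k::complete_ultrametric_field ^ 'n::finite"
  assumes f: "ps_bounded r C f" and \<sigma>: "0 < \<sigma>" "\<sigma> < r"
    and x: "\<And>i. absval (x $ i) \<le> \<sigma>" and y: "\<And>i. absval (y $ i) \<le> \<sigma>"
  shows "fact s * (\<Sum>ls\<in>{ls. length ls = t}. taylor_part x y s (foldr ps_partial ls f) * (\<Prod>l\<leftarrow>ls. y $ l))
      = fact (s + t) * taylor_part x y (s + t) f"
proof (induction t arbitrary: s)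
  case (Suc t)
  have "(\<Sum>l\<in>UNIV. taylor_part x y s (foldr ps_partial (l # ls) f) * (\<Prod>l\<leftarrow>l # ls. y $ l))
      = of_nat (Suc s) * (taylor_part x y (Suc s) (foldr ps_partial ls f) * (\<Prod>l\<leftarrow>ls. y $ l))" for ls
  proof -
    have "(\<Sum>l\<in>UNIV. taylor_part x y s (foldr ps_partial (l # ls) f) * (\<Prod>l\<leftarrow>l # ls. y $ l))
       = (\<Sum>l\<in>UNIV. taylor_part x y s (ps_partial l (foldr ps_partial ls f)) * y $ l) * (\<Prod>l\<leftarrow>ls. y $ l)"
      by (simp add: sum_distrib_right mult.assoc)
    also have "(\<Sum>l\<in>UNIV. taylor_part x y s (ps_partial l (foldr ps_partial ls f)) * y $ l)
       = of_nat (Suc s) * taylor_part x y (Suc s) (foldr ps_partial ls f)"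
      by (rule taylor_part_partial[OF ps_bounded_partials[OF f] \<sigma> x y]) (use \<sigma> in auto)
    finally show ?thesis by (simp add: mult.assoc)
  qed
  then have "fact s * (\<Sum>ls\<in>{ls. length ls = Suc t}. taylor_part x y s (foldr ps_partial ls f) * (\<Prod>l\<leftarrow>ls. y $ l))
     = fact (Suc s) * (\<Sum>ls\<in>{ls. length ls = t}. taylor_part x y (Suc s) (foldr ps_partial ls f) * (\<Prod>l\<leftarrow>ls. y $ l))"
    by (simp only: sum_lists_Suc sum_distrib_left[symmetric] fact_Suc of_nat_mult mult.assoc mult.left_commute[of "fact s"])
  also have "\<dots> = fact (Suc s + t) * taylor_part x y (Suc s + t) f" by (rule Suc.IH)
  finally show ?case by simp
qed simp

lemma taylor_expansion:
  fixes x y :: "'k::complete_ultrametric_field ^ 'n::finite"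
  assumes f: "ps_bounded r C f" and \<sigma>: "0 < \<sigma>" "\<sigma> < r"
    and x: "\<And>i. absval (x $ i) \<le> \<sigma>" and y: "\<And>i. absval (y $ i) \<le> \<sigma>"
  shows "((\<lambda>t. 1 / fact t * (\<Sum>ls\<in>{ls. length ls = t}. ps_eval (foldr ps_partial ls f) x * (\<Prod>l\<leftarrow>ls. y $ l)))
     has_sum ps_eval f (x + y)) UNIV"
proof -
  have "taylor_part x y t f
      = 1 / fact t * (\<Sum>ls\<in>{ls. length ls = t}. ps_eval (foldr ps_partial ls f) x * (\<Prod>l\<leftarrow>ls. y $ l))" for t
    using taylor_part_iterated[OF f \<sigma> x y, of 0 t] by (simp add: taylor_part_0)
  then show ?thesis using has_sum_taylor_parts[OF f \<sigma> x y] by simp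
qed

text \<open>Every homogeneous part of \<open>(x + y)\<^sup>\<gamma>\<close> of positive degree in \<open>y\<close> is smaller than the bound
  \<open>r\<^bsup>|\<gamma>|\<^esup>\<close> on the monomial by a factor \<open>\<delta> / r\<close>; hence so is the increment of \<open>f\<close>.\<close>

lemma ps_eval_increment:
  fixes x y :: "'k::complete_ultrametric_field ^ 'n::finite"
  assumes f: "ps_bounded r C f" and \<sigma>: "0 < \<sigma>" "\<sigma> < r"
    and x: "\<And>i. absval (x $ i) \<le> \<sigma>" and y: "\<And>i. absval (y $ i) \<le> \<delta>" and \<delta>: "0 \<le> \<delta>" "\<delta> \<le> \<sigma>"
  shows "absval (ps_eval f (x + y) - ps_eval f x) \<le> C / r * \<delta>"
proof -
  let ?m = "\<lambda>x :: 'k ^ 'n. \<lambda>\<gamma>. (\<Prod>i\<in>UNIV. (x $ i) ^ \<gamma> i)"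
  have xy: "absval ((x + y) $ i) \<le> \<sigma>" for i
    using uf_absval_add[of "x $ i" "y $ i"] x[of i] y[of i] \<delta> by simp
  have eq: "f \<gamma> * (?m (x + y) \<gamma> - ?m x \<gamma>) = f \<gamma> * ?m (x + y) \<gamma> + - (f \<gamma> * ?m x \<gamma>)" for \<gamma>
    by (simp add: right_diff_distrib)
  have "((\<lambda>\<gamma>. f \<gamma> * ?m (x + y) \<gamma> + - (f \<gamma> * ?m x \<gamma>)) has_sum (ps_eval f (x + y) + - ps_eval f x)) UNIV"
    by (intro has_sum_add has_sum_uminusI has_sum_ps_eval[OF f \<sigma>] x xy)
  then have "ps_eval f (x + y) - ps_eval f x = (\<Sum>\<^sub>\<infinity>\<gamma>. f \<gamma> * (?m (x + y) \<gamma> - ?m x \<gamma>))"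
    unfolding eq by (simp only: infsumI[symmetric] diff_conv_add_uminus)
  also have "absval \<dots> \<le> C / r * \<delta>"
  proof (rule absval_infsum_le)
    fix \<gamma>
    let ?c = "Polynomial.coeff (line_poly x y \<gamma>)"
    have "?m (x + y) \<gamma> = poly (line_poly x y \<gamma>) 1"
      by (simp add: poly_line_poly)
    also have "\<dots> = (\<Sum>t\<le>Polynomial.degree (line_poly x y \<gamma>). ?c t)"
      by (simp add: poly_altdef)
    also have "\<dots> = ?c 0 + (\<Sum>t\<in>{0<..Polynomial.degree (line_poly x y \<gamma>)}. ?c t)"
      by (simp add: atMost_atLeast0 sum.head)
    also have "?c 0 = ?m x \<gamma>"
      by (simp add: poly_0_coeff_0[symmetric] poly_line_poly)
    finally have "?m (x + y) \<gamma> - ?m x \<gamma> = (\<Sum>t\<in>{0<..Polynomial.degree (line_poly x y \<gamma>)}. ?c t)"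
      by simp
    also have "absval \<dots> \<le> r ^ mdeg \<gamma> * (\<delta> / r)"
    proof (rule uf_absval_sum_le)
      fix t assume "t \<in> {0<..Polynomial.degree (line_poly x y \<gamma>)}"
      then have "(\<delta> / r) ^ t \<le> \<delta> / r"
        using \<delta> \<sigma> power_decreasing[of 1 t "\<delta> / r"] by simp
      moreover have "absval (?c t) \<le> r ^ mdeg \<gamma> * (\<delta> / r) ^ t"
        using order_trans[OF x less_imp_le[OF \<sigma>(2)]] y \<sigma> \<delta> by (intro coeff_line_poly_bound) auto
      ultimately show "absval (?c t) \<le> r ^ mdeg \<gamma> * (\<delta> / r)"
        using \<sigma> by (elim order_trans) (intro mult_left_mono, auto)
    qed (use \<sigma> \<delta> in auto)
    finally have "absval (f \<gamma> * (?m (x + y) \<gamma> - ?m x \<gamma>)) \<le> absval (f \<gamma>) * (r ^ mdeg \<gamma> * (\<delta> / r))"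
      unfolding uf_absval_mult by (intro mult_left_mono) auto
    also have "\<dots> = absval (f \<gamma>) * r ^ mdeg \<gamma> * (\<delta> / r)" by simp
    also have "\<dots> \<le> C * (\<delta> / r)"
      using f \<delta> \<sigma> unfolding ps_bounded_def by (intro mult_right_mono) auto
    finally show "absval (f \<gamma> * (?m (x + y) \<gamma> - ?m x \<gamma>)) \<le> C / r * \<delta>" by simp
  qed (use ps_bounded_nonneg[OF f] \<sigma> \<delta> in auto)
  finally show ?thesis .
qed

section \<open>Vectors and the sup norm\<close>

lemma sup_norm_le_iff: "sup_norm x \<le> c \<longleftrightarrow> (\<forall>i. absval (x $ i) \<le> c)"
  by (simp add: sup_norm_def)

lemma sup_norm_less_iff: "sup_norm x < c \<longleftrightarrow> (\<forall>i. absval (x $ i) < c)"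
  by (simp add: sup_norm_def)

lemma absval_le_sup_norm: "absval (x $ i) \<le> sup_norm x"
  using sup_norm_le_iff[of x "sup_norm x"] by simp

lemma sup_norm_nonneg: "0 \<le> sup_norm x"
  using absval_le_sup_norm uf_absval_nonneg by (rule order_trans[rotated])

lemma sup_norm_zero [simp]: "sup_norm 0 = 0"
  by (simp add: sup_norm_def)

lemma sup_norm_eq_0: "sup_norm x = 0 \<Longrightarrow> x = 0"
  using sup_norm_le_iff[of x 0] by (auto simp: vec_eq_iff order.eq_iff[of "absval _"] simp flip: uf_absval_eq_zero)

lemma sup_norm_minus: "sup_norm (- x) = sup_norm x"
  by (simp add: sup_norm_def)

lemma sup_norm_add: "sup_norm (x + y) \<le> max (sup_norm x) (sup_norm y)"
  unfolding sup_norm_le_iff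
proof
  fix i
  have "absval ((x + y) $ i) \<le> max (absval (x $ i)) (absval (y $ i))" by (simp add: uf_absval_add)
  also have "\<dots> \<le> max (sup_norm x) (sup_norm y)" by (intro max.mono absval_le_sup_norm)
  finally show "absval ((x + y) $ i) \<le> max (sup_norm x) (sup_norm y)" .
qed

lemma sup_norm_diff: "sup_norm (x - y) \<le> max (sup_norm x) (sup_norm y)"
  using sup_norm_add[of x "- y"] by (simp add: sup_norm_minus)

lemma sup_norm_matrix_vector:
  assumes "\<And>i j. absval (A $ i $ j) \<le> c" "0 \<le> c"
  shows "sup_norm (A *v u) \<le> c * sup_norm u"
  unfolding sup_norm_le_iff
proof
  fix i
  have "absval (A $ i $ j * u $ j) \<le> c * sup_norm u" for j
    unfolding uf_absval_mult by (intro mult_mono assms absval_le_sup_norm) simp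
  then show "absval ((A *v u) $ i) \<le> c * sup_norm u"
    unfolding matrix_vector_mult_def using assms(2) sup_norm_nonneg[of u]
    by (simp add: uf_absval_sum_le)
qed

lemma mem_B0_0: "x \<in> B0 0 \<rho> \<longleftrightarrow> sup_norm x < \<rho>"
  by (simp add: B0_def sup_norm_minus)

lemma sup_norm_le_dist: "sup_norm (x - y) \<le> dist x y"
  unfolding sup_norm_le_iff using dist_vec_nth_le[of x _ y] by (simp add: uf_dist)

text \<open>Sums of vectors are handled through their components: the arithmetic of infinite sums is
  developed for the field only.\<close>

lemma has_sum_vecI:
  fixes f :: "'a \<Rightarrow> 'k::complete_ultrametric_field ^ 'n::finite"
  assumes "\<And>i. ((\<lambda>a. f a $ i) has_sum s $ i) A"
  shows "(f has_sum s) A"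
  using assms unfolding has_sum_def by (intro vec_tendstoI) simp

lemma has_sum_vec_nth:
  fixes f :: "'a \<Rightarrow> 'k::complete_ultrametric_field ^ 'n::finite"
  assumes "(f has_sum s) A"
  shows "((\<lambda>a. f a $ i) has_sum s $ i) A"
  using tendsto_vec_nth[OF assms[unfolded has_sum_def], of i] unfolding has_sum_def by simp

lemma has_sum_vec_unique:
  fixes f :: "'a \<Rightarrow> 'k::complete_ultrametric_field ^ 'n::finite"
  assumes "(f has_sum s) A" "(f has_sum t) A"
  shows "s = t"
  unfolding vec_eq_iff using has_sum_unique[OF has_sum_vec_nth[OF assms(1)] has_sum_vec_nth[OF assms(2)]] by blast

lemma ps_eval_lipschitz:
  fixes x y :: "'k::complete_ultrametric_field ^ 'n::finite"
  assumes f: "ps_bounded r C f" and r: "0 < r" and x: "x \<in> B0 0 r" and y: "y \<in> B0 0 r"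
  shows "absval (ps_eval f x - ps_eval f y) \<le> C / r * sup_norm (x - y)"
proof -
  have "max (sup_norm x) (sup_norm y) < r" using x y by (simp add: mem_B0_0)
  then obtain \<sigma> where "max (sup_norm x) (sup_norm y) < \<sigma>" "\<sigma> < r" using dense by blast
  then have \<sigma>: "0 < \<sigma>" "\<sigma> < r" "max (sup_norm x) (sup_norm y) \<le> \<sigma>"
    using sup_norm_nonneg[of x] by auto
  have "sup_norm (x - y) \<le> \<sigma>" using sup_norm_diff \<sigma>(3) by (rule order_trans)
  moreover have "absval (y $ i) \<le> \<sigma>" for i using absval_le_sup_norm[of y i] \<sigma>(3) by simp
  ultimately show ?thesis
    using ps_eval_increment[OF f \<sigma>(1,2), of y "x - y" "sup_norm (x - y)"]
      absval_le_sup_norm[of "x - y"] sup_norm_nonneg[of "x - y"] by simp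
qed

lemma continuous_ps_eval:
  fixes f :: "('n::finite \<Rightarrow> nat) \<Rightarrow> 'k::complete_ultrametric_field"
  assumes f: "ps_bounded r C f" and r: "0 < r"
  shows "continuous_on (B0 0 r) (ps_eval f)"
proof (rule lipschitz_on_continuous_on[of "C / r"], rule lipschitz_onI)
  fix x y :: "'k ^ 'n" assume "x \<in> B0 0 r" "y \<in> B0 0 r"
  from ps_eval_lipschitz[OF f r this]
  have "dist (ps_eval f x) (ps_eval f y) \<le> C / r * sup_norm (x - y)" by (simp add: uf_dist)
  also have "\<dots> \<le> C / r * dist x y"
    using ps_bounded_nonneg[OF f r] r by (intro mult_left_mono sup_norm_le_dist) simp
  finally show "dist (ps_eval f x) (ps_eval f y) \<le> C / r * dist x y" .
qed (use ps_bounded_nonneg[OF f r] r in simp)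

section \<open>Products over lists of trees\<close>

lemma vanishing_reindex:
  assumes "vanishing f B" "inj_on h A" "h ` A \<subseteq> B"
  shows "vanishing (\<lambda>a. f (h a)) A"
  unfolding vanishing_def
proof (intro allI impI)
  fix e :: real assume "e > 0"
  then have "finite {b \<in> B. e \<le> absval (f b)}" using assms(1) by (simp add: vanishing_def)
  then have "finite (h ` {a \<in> A. e \<le> absval (f (h a))})"
    by (rule finite_subset[rotated]) (use assms(3) in auto)
  then show "finite {a \<in> A. e \<le> absval (f (h a))}"
    by (rule finite_imageD) (rule inj_on_subset[OF assms(2)], auto)
qed

text \<open>Distributivity for a product of infinite sums, one factor for each entry of \<open>ls\<close>: the
  product is summed over all lists that pick an index for each factor.\<close>

lemma list_product_of_sums:
  fixes g :: "'i \<Rightarrow> 'a \<Rightarrow> 'k::complete_ultrametric_field"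
  assumes g: "\<And>l. vanishing (g l) UNIV"
  shows "vanishing (\<lambda>as. prod_list (map2 g ls as)) {as. length as = length ls}" (is ?V)
    and "((\<lambda>as. prod_list (map2 g ls as)) has_sum (\<Prod>l\<leftarrow>ls. infsum (g l) UNIV)) {as. length as = length ls}" (is ?S)
proof -
  have "?V \<and> ?S"
  proof (induction ls)
    case Nil
    show ?case by (simp add: vanishing_def has_sum_finiteI)
  next
    case (Cons l ls)
    let ?P = "\<lambda>ls as. prod_list (map2 g ls as)" and ?L = "{as :: 'a list. length as = length ls}"
    let ?L' = "{as :: 'a list. length as = length (l # ls)}"
    let ?F = "\<lambda>(a, as). g l a * ?P ls as"
    have V: "vanishing ?F (UNIV \<times> ?L)"
      using Cons by (intro vanishing_product g) auto
    have eq: "?P (l # ls) as = ?F (hd as, tl as)" if "as \<in> ?L'" for as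
      using that by (auto simp: length_Suc_conv)
    have "vanishing (\<lambda>as. ?F (hd as, tl as)) ?L'"
      by (rule vanishing_reindex[OF V]) (auto simp: inj_on_def length_Suc_conv)
    then have "vanishing (?P (l # ls)) ?L'"
      unfolding vanishing_def using eq by (simp cong: conj_cong)
    moreover have "(?P (l # ls) has_sum (infsum (g l) UNIV * (\<Prod>l\<leftarrow>ls. infsum (g l) UNIV))) ?L'"
    proof -
      have "infsum (?P ls) ?L = (\<Prod>l\<leftarrow>ls. infsum (g l) UNIV)"
        using Cons by (simp add: infsumI)
      then have "(?F has_sum (infsum (g l) UNIV * (\<Prod>l\<leftarrow>ls. infsum (g l) UNIV))) (UNIV \<times> ?L)"
        using has_sum_product[OF g[of l], of "?P ls" ?L] Cons by simp
      also have "?this \<longleftrightarrow> ?thesis"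
        by (rule has_sum_reindex_bij_witness[where j = "\<lambda>(a, as). a # as" and i = "\<lambda>as. (hd as, tl as)"])
           (auto simp: length_Suc_conv)
      finally show ?thesis .
    qed
    ultimately show ?case by simp
  qed
  then show ?V ?S by auto
qed

lemma prod_nth_eq_prod_list:
  fixes vs :: "('k::comm_monoid_mult ^ 'n) list"
  assumes "length ls = length vs"
  shows "(\<Prod>s<length vs. (vs ! s) $ (ls ! s)) = prod_list (map2 (\<lambda>l v. v $ l) ls vs)"
  using assms
  by (induction ls vs rule: list_induct2) (simp_all add: prod.lessThan_Suc_shift del: prod.lessThan_Suc)

lemma mat_diff_nth:
  "mat_diff G x vs $ i $ j = (\<Sum>ls\<in>{ls. length ls = length vs}.
     ps_eval (foldr ps_partial ls (\<lambda>\<alpha>. G i \<alpha> $ j)) x * prod_list (map2 (\<lambda>l v. v $ l) ls vs))"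
  unfolding mat_diff_def by (simp add: prod_nth_eq_prod_list)

lemma mat_diff_Nil: "mat_diff G x [] = mat_eval G x"
  by (simp add: vec_eq_iff mat_diff_nth mat_eval_def)

lemma absval_prod_list_map2_le:
  assumes "length ls = length vs"
  shows "absval (prod_list (map2 (\<lambda>l v. v $ l) ls vs)) \<le> (\<Prod>v\<leftarrow>vs. sup_norm v)"
  using assms
proof (induction ls vs rule: list_induct2)
  case (Cons l ls v vs)
  then show ?case
    by (simp add: uf_absval_mult mult_mono absval_le_sup_norm sup_norm_nonneg)
qed simp

section \<open>The tree expansion\<close>

text \<open>The assumptions \<open>fact_linear\<close> and \<open>fact_unit\<close> carry what the identification of the residue
  field with a subfield of \<open>k\<close> contributes: the numbers \<open>1 / t!\<close> are scalars for \<open>\<Lambda>\<close> of absolute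
  value \<open>1\<close>.\<close>

locale tree_equation =
  fixes G :: "'n::finite \<Rightarrow> ('n \<Rightarrow> nat) \<Rightarrow> 'k::complete_ultrametric_field ^ 'l::finite"
    and \<Lambda> :: "'k ^ 'n \<Rightarrow> 'k ^ 'n"
    and r M :: real
  assumes additive: "\<And>x y. \<Lambda> (x + y) = \<Lambda> x + \<Lambda> y"
    and fact_linear: "\<And>t x. \<Lambda> ((1 / fact t) *s x) = (1 / fact t) *s \<Lambda> x"
    and fact_unit: "\<And>t. absval (fact t :: 'k) = 1"
    and nonexpanding: "\<And>x. sup_norm (\<Lambda> x) \<le> sup_norm x"
    and r_pos: "0 < r" and M_pos: "0 < M"
    and bounded: "\<And>i j. ps_bounded r M (\<lambda>\<alpha>. G i \<alpha> $ j)"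
begin

lemma \<Lambda>_zero: "\<Lambda> 0 = 0"
  using additive[of 0 0] by simp

lemma \<Lambda>_diff: "\<Lambda> (x - y) = \<Lambda> x - \<Lambda> y"
  using additive[of "x - y" y] by (simp add: algebra_simps)

lemma \<Lambda>_sum: "\<Lambda> (sum f A) = (\<Sum>a\<in>A. \<Lambda> (f a))"
  by (induction A rule: infinite_finite_induct) (simp_all add: \<Lambda>_zero additive)

lemma continuous_\<Lambda>: "continuous_on A \<Lambda>"
proof (rule continuous_on_subset)
  have "continuous_on UNIV (\<lambda>x. \<Lambda> x $ i)" for i
  proof (rule lipschitz_on_continuous_on[of 1], rule lipschitz_onI)
    fix x y
    have "dist (\<Lambda> x $ i) (\<Lambda> y $ i) = absval (\<Lambda> (x - y) $ i)" by (simp add: uf_dist \<Lambda>_diff)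
    also have "\<dots> \<le> dist x y"
      by (rule order_trans[OF absval_le_sup_norm order_trans[OF nonexpanding sup_norm_le_dist]])
    finally show "dist (\<Lambda> x $ i) (\<Lambda> y $ i) \<le> 1 * dist x y" by simp
  qed simp
  then have "continuous_on UNIV (\<lambda>x. \<chi> i. \<Lambda> x $ i)" by (rule continuous_on_vec_lambda)
  then show "continuous_on UNIV \<Lambda>" by simp
qed simp

lemma mat_diff_bound:
  assumes x: "sup_norm x \<le> r"
  shows "absval (mat_diff G x vs $ i $ j) \<le> M / r ^ length vs * (\<Prod>v\<leftarrow>vs. sup_norm v)"
proof -
  have pos: "0 \<le> M / r ^ length vs" "0 \<le> (\<Prod>v\<leftarrow>vs. sup_norm v)"
    using r_pos M_pos by (auto intro!: prod_list_nonneg simp: sup_norm_nonneg)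
  show ?thesis
    unfolding mat_diff_nth
  proof (rule uf_absval_sum_le)
    fix ls :: "'n list" assume "ls \<in> {ls. length ls = length vs}"
    then have len: "length ls = length vs" by simp
    have "absval (ps_eval (foldr ps_partial ls (\<lambda>\<alpha>. G i \<alpha> $ j)) x) \<le> M / r ^ length vs"
      using ps_eval_bound[OF ps_bounded_partials[OF bounded r_pos] r_pos, of x ls i j] x len
      by (simp add: sup_norm_le_iff)
    then show "absval (ps_eval (foldr ps_partial ls (\<lambda>\<alpha>. G i \<alpha> $ j)) x * prod_list (map2 (\<lambda>l v. v $ l) ls vs))
        \<le> M / r ^ length vs * (\<Prod>v\<leftarrow>vs. sup_norm v)"
      unfolding uf_absval_mult by (intro mult_mono absval_prod_list_map2_le len pos) auto
  qed (rule mult_nonneg_nonneg[OF pos])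
qed

text \<open>By linearity the factor \<open>1 / t!\<close> is moved into the matrix, and a tree without subtrees
  becomes the case \<open>t = 0\<close>; the recursion then has a single form.\<close>

lemma tree_val_Node:
  "tree_val \<Lambda> G (Node ts) u w
     = \<Lambda> ((\<chi> i j. 1 / fact (length ts) * mat_diff G (\<Lambda> w) (map (\<lambda>\<theta>. tree_val \<Lambda> G \<theta> u w) ts) $ i $ j) *v u)"
proof -
  have scale: "(\<chi> i j. c * A $ i $ j) *v u = c *s (A *v u)" for c and A :: "'k ^ 'l ^ 'n"
    by (simp add: vec_eq_iff matrix_vector_mult_def sum_distrib_left mult.assoc)
  show ?thesis unfolding scale by (simp add: mat_diff_Nil fact_linear)
qed

text \<open>Bounds the matrix of the tree \<open>Node ts\<close> in terms of values \<open>X\<close> of the subtrees of size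
  \<open>r q\<^sup>N\<close>: the factor \<open>r\<^sup>-\<^sup>t\<close> from \<open>t\<close> differentiations is compensated by the factors \<open>r\<close> of the
  \<open>t\<close> subtrees.\<close>

lemma mat_diff_trees_bound:
  assumes x: "sup_norm x \<le> r" and X: "\<And>\<theta>. \<theta> \<in> set ts \<Longrightarrow> sup_norm (X \<theta>) \<le> r * q ^ nodes \<theta>" and q: "0 \<le> q"
  shows "absval (1 / fact (length ts) * mat_diff G x (map X ts) $ i $ j) \<le> M * q ^ (\<Sum>\<theta>\<leftarrow>ts. nodes \<theta>)"
proof -
  have "(\<Prod>v\<leftarrow>map X ts. sup_norm v) \<le> r ^ length ts * q ^ (\<Sum>\<theta>\<leftarrow>ts. nodes \<theta>)"
    using X
  proof (induction ts)
    case (Cons \<theta> ts)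
    have "(\<Prod>v\<leftarrow>map X (\<theta> # ts). sup_norm v)
        \<le> (r * q ^ nodes \<theta>) * (r ^ length ts * q ^ (\<Sum>\<theta>\<leftarrow>ts. nodes \<theta>))"
      using Cons r_pos q by (auto intro!: mult_mono prod_list_nonneg simp: sup_norm_nonneg o_def)
    then show ?case by (simp add: power_add mult_ac)
  qed simp
  then have "M / r ^ length ts * (\<Prod>v\<leftarrow>map X ts. sup_norm v)
      \<le> M / r ^ length ts * (r ^ length ts * q ^ (\<Sum>\<theta>\<leftarrow>ts. nodes \<theta>))"
    using M_pos r_pos by (intro mult_left_mono) auto
  also have "\<dots> = M * q ^ (\<Sum>\<theta>\<leftarrow>ts. nodes \<theta>)"
    using r_pos by simp
  finally have *: "absval (mat_diff G x (map X ts) $ i $ j) \<le> M * q ^ (\<Sum>\<theta>\<leftarrow>ts. nodes \<theta>)"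
    using mat_diff_bound[OF x, of "map X ts" i j] by simp
  have "absval (1 / fact (length ts) :: 'k) * absval (fact (length ts) :: 'k) = 1"
    by (simp flip: uf_absval_mult)
  then have "absval (1 / fact (length ts) :: 'k) = 1" by (simp add: fact_unit)
  with * show ?thesis by (simp only: uf_absval_mult mult_1)
qed

context
  fixes u :: "'k ^ 'l" and w :: "'k ^ 'n" and q :: real
  assumes u: "u \<in> B0 0 (r / M)" and w: "w \<in> B0 0 r"
  defines "q \<equiv> M * sup_norm u / r"
begin

lemma q_nonneg: "0 \<le> q"
  using M_pos r_pos by (simp add: q_def sup_norm_nonneg)

lemma q_less_1: "q < 1"
  using u M_pos r_pos by (simp add: q_def mem_B0_0 field_simps)

lemma \<Lambda>_w_less: "sup_norm (\<Lambda> w) < r"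
  using w nonexpanding[of w] by (simp add: mem_B0_0)

text \<open>The powers of \<open>q\<close> of the subtrees multiply, and the factor \<open>M \<parallel>u\<parallel> = r q\<close> accounts for the
  root.\<close>

lemma tree_val_bound: "sup_norm (tree_val \<Lambda> G \<theta> u w) \<le> r * q ^ nodes \<theta>"
proof (induction \<theta>)
  case (Node ts)
  let ?A = "\<chi> i j. 1 / fact (length ts) * mat_diff G (\<Lambda> w) (map (\<lambda>\<theta>. tree_val \<Lambda> G \<theta> u w) ts) $ i $ j"
  have "sup_norm (tree_val \<Lambda> G (Node ts) u w) \<le> sup_norm (?A *v u)"
    unfolding tree_val_Node by (rule nonexpanding)
  also have "\<dots> \<le> (M * q ^ (\<Sum>\<theta>\<leftarrow>ts. nodes \<theta>)) * sup_norm u"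
  proof (rule sup_norm_matrix_vector)
    show "absval (?A $ i $ j) \<le> M * q ^ (\<Sum>\<theta>\<leftarrow>ts. nodes \<theta>)" for i j
      using mat_diff_trees_bound[of "\<Lambda> w" ts "\<lambda>\<theta>. tree_val \<Lambda> G \<theta> u w" q i j] \<Lambda>_w_less Node q_nonneg
      by simp
  qed (use M_pos q_nonneg in auto)
  also have "\<dots> = r * q ^ nodes (Node ts)"
    using r_pos by (simp add: q_def)
  finally show ?case .
qed

lemma q_power_nodes: "q ^ nodes \<theta> \<le> q"
proof -
  obtain n where "nodes \<theta> = Suc n" by (cases \<theta>) simp
  then show ?thesis using q_nonneg q_less_1 by (simp add: mult_left_le power_le_one)
qed

lemma tree_val_in_B0: "tree_val \<Lambda> G \<theta> u w \<in> B0 0 r"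
proof -
  have "q ^ nodes \<theta> < 1" using q_power_nodes q_less_1 by (rule order.strict_trans1)
  then have "r * q ^ nodes \<theta> < r" using r_pos by simp
  with tree_val_bound[of \<theta>] show ?thesis by (simp add: mem_B0_0)
qed

lemma vanishing_tree_val: "vanishing (\<lambda>\<theta>. tree_val \<Lambda> G \<theta> u w $ i) UNIV"
proof (rule vanishing_geometric[where d = nodes])
  show "finite {\<theta> \<in> UNIV. nodes \<theta> = n}" for n
    using finite_trees[of n] by (simp add: trees_def)
  show "absval (tree_val \<Lambda> G \<theta> u w $ i) \<le> r * q ^ nodes \<theta>" for \<theta>
    by (rule order_trans[OF absval_le_sup_norm tree_val_bound])
qed (rule q_nonneg q_less_1)+

definition tree_total :: "'k ^ 'n" where
  "tree_total = (\<chi> i. \<Sum>\<^sub>\<infinity>\<theta>. tree_val \<Lambda> G \<theta> u w $ i)"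

lemma has_sum_tree_total: "((\<lambda>\<theta>. tree_val \<Lambda> G \<theta> u w) has_sum tree_total) UNIV"
  by (rule has_sum_vecI) (simp add: tree_total_def vanishing_imp_summable vanishing_tree_val)

lemma tree_total_less: "sup_norm tree_total < r"
proof -
  have "absval (tree_val \<Lambda> G \<theta> u w $ i) \<le> r * q" for \<theta> i
  proof -
    have "r * q ^ nodes \<theta> \<le> r * q" using q_power_nodes r_pos by simp
    then show ?thesis using tree_val_bound[of \<theta>] absval_le_sup_norm[of "tree_val \<Lambda> G \<theta> u w" i] by linarith
  qed
  then have "sup_norm tree_total \<le> r * q"
    unfolding sup_norm_le_iff tree_total_def using r_pos q_nonneg by (auto intro!: absval_infsum_le)
  also have "\<dots> < r" using r_pos q_less_1 by simp
  finally show ?thesis .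
qed

text \<open>Grouping the sum over all trees by the number of nodes; the index is shifted because every
  tree has at least one node.\<close>

lemma tree_level_sums: "(\<lambda>N. tree_level \<Lambda> G u w (Suc N)) sums tree_total"
  unfolding sums_def
proof (rule vec_tendstoI)
  fix i
  let ?v = "\<lambda>\<theta>. tree_val \<Lambda> G \<theta> u w $ i"
  have "(?v has_sum tree_total $ i) UNIV" by (rule has_sum_vec_nth[OF has_sum_tree_total])
  also have "?this \<longleftrightarrow> ((\<lambda>(N, \<theta>). ?v \<theta>) has_sum tree_total $ i) (Sigma UNIV (\<lambda>N. trees (Suc N)))"
  proof (rule has_sum_reindex_bij_witness[where i = snd and j = "\<lambda>\<theta>. (nodes \<theta> - 1, \<theta>)"])
    fix \<theta> :: rtree
    show "(nodes \<theta> - 1, \<theta>) \<in> Sigma UNIV (\<lambda>N. trees (Suc N))" by (cases \<theta>) (simp add: trees_def)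
  qed (auto simp: trees_def)
  finally have "((\<lambda>N. tree_level \<Lambda> G u w (Suc N) $ i) has_sum tree_total $ i) UNIV"
  proof (rule has_sum_SigmaD)
    show "((\<lambda>\<theta>. case (N, \<theta>) of (N, \<theta>) \<Rightarrow> ?v \<theta>) has_sum tree_level \<Lambda> G u w (Suc N) $ i) (trees (Suc N))" for N
      by (rule has_sum_finiteI) (simp_all add: finite_trees tree_level_def)
  qed
  then have "(\<lambda>N. tree_level \<Lambda> G u w (Suc N) $ i) sums tree_total $ i" by (rule has_sum_imp_sums)
  then show "(\<lambda>n. (\<Sum>N<n. tree_level \<Lambda> G u w (Suc N)) $ i) \<longlonglongrightarrow> tree_total $ i"
    by (simp add: sums_def)
qed

lemma tree_solution_eq: "tree_solution \<Lambda> G u w = \<Lambda> w + tree_total"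
  using sums_unique[OF tree_level_sums] by (simp add: tree_solution_def)

lemma tree_solution_in_B0: "tree_solution \<Lambda> G u w \<in> B0 0 r"
  unfolding tree_solution_eq mem_B0_0
  using sup_norm_add[of "\<Lambda> w" tree_total] \<Lambda>_w_less tree_total_less by simp

text \<open>Taylor's formula for \<open>G (\<Lambda> w + v)\<close> with the sum over all trees for \<open>v\<close>, each factor \<open>v\<close>
  being expanded by distributivity: a term of order \<open>t\<close> picks one tree for each of the \<open>t\<close> slots
  of \<open>d\<^sup>tG\<close>.\<close>

lemma has_sum_mat_eval_trees:
  "((\<lambda>ts. 1 / fact (length ts) * mat_diff G (\<Lambda> w) (map (\<lambda>\<theta>. tree_val \<Lambda> G \<theta> u w) ts) $ i $ j) has_sum
     mat_eval G (\<Lambda> w + tree_total) $ i $ j) UNIV"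
proof -
  let ?x = "\<Lambda> w" and ?X = "\<lambda>\<theta>. tree_val \<Lambda> G \<theta> u w" and ?f = "\<lambda>\<alpha>. G i \<alpha> $ j"
  let ?F = "\<lambda>ts. 1 / fact (length ts) * mat_diff G ?x (map ?X ts) $ i $ j"
  let ?S = "Sigma UNIV (\<lambda>t. {ts :: rtree list. length ts = t})"
  (* Taylor's formula wants both vectors in a closed polydisc of radius strictly below r *)
  have "max (sup_norm ?x) (sup_norm tree_total) < r"
    using \<Lambda>_w_less tree_total_less by simp
  then obtain \<sigma> where "max (sup_norm ?x) (sup_norm tree_total) < \<sigma>" "\<sigma> < r" using dense by blast
  then have "0 < \<sigma>" "\<sigma> < r" "sup_norm ?x \<le> \<sigma>" "sup_norm tree_total \<le> \<sigma>"
    using sup_norm_nonneg[of ?x] by auto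
  then have \<sigma>: "0 < \<sigma>" "\<sigma> < r" "\<And>i. absval (?x $ i) \<le> \<sigma>" "\<And>i. absval (tree_total $ i) \<le> \<sigma>"
    by (auto simp: sup_norm_le_iff)
  have V: "vanishing ?F UNIV"
  proof (rule vanishing_geometric[where d = "\<lambda>ts. \<Sum>\<theta>\<leftarrow>ts. nodes \<theta>"])
    fix n
    have "{ts \<in> UNIV. (\<Sum>\<theta>\<leftarrow>ts. nodes \<theta>) = n} = Node -` trees (Suc n)"
      by (auto simp: trees_def)
    then show "finite {ts \<in> UNIV. (\<Sum>\<theta>\<leftarrow>ts. nodes \<theta>) = n}"
      by (simp add: finite_vimageI finite_trees inj_def)
  next
    fix ts show "absval (?F ts) \<le> M * q ^ (\<Sum>\<theta>\<leftarrow>ts. nodes \<theta>)"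
      by (rule mat_diff_trees_bound[OF less_imp_le[OF \<Lambda>_w_less] tree_val_bound q_nonneg])
  qed (rule q_nonneg q_less_1)+
  have "((\<lambda>(t, ts). ?F ts) has_sum ps_eval ?f (?x + tree_total)) ?S"
  proof (rule has_sum_SigmaI)
    fix t
    have "((\<lambda>ts. \<Sum>ls\<in>{ls. length ls = t}. ps_eval (foldr ps_partial ls ?f) ?x * prod_list (map2 (\<lambda>l \<theta>. ?X \<theta> $ l) ls ts))
        has_sum (\<Sum>ls\<in>{ls. length ls = t}. ps_eval (foldr ps_partial ls ?f) ?x * (\<Prod>l\<leftarrow>ls. tree_total $ l))) {ts. length ts = t}"
    proof (intro has_sum_sum has_sum_cmult_right)
      fix ls :: "'n list" assume "ls \<in> {ls. length ls = t}"
      then show "((\<lambda>ts. prod_list (map2 (\<lambda>l \<theta>. ?X \<theta> $ l) ls ts)) has_sum (\<Prod>l\<leftarrow>ls. tree_total $ l)) {ts. length ts = t}"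
        using list_product_of_sums(2)[of "\<lambda>l \<theta>. ?X \<theta> $ l" ls, OF vanishing_tree_val]
        by (simp add: tree_total_def)
    qed
    from has_sum_cmult_right[OF this, of "1 / fact t"]
    show "((\<lambda>ts. case (t, ts) of (t, ts) \<Rightarrow> ?F ts) has_sum 1 / fact t *
       (\<Sum>ls\<in>{ls. length ls = t}. ps_eval (foldr ps_partial ls ?f) ?x * (\<Prod>l\<leftarrow>ls. tree_total $ l))) {ts. length ts = t}"
      by (rule has_sum_cong[THEN iffD1, rotated]) (simp add: mat_diff_nth zip_map2 o_def split_def)
  next
    show "((\<lambda>t. 1 / fact t * (\<Sum>ls\<in>{ls. length ls = t}. ps_eval (foldr ps_partial ls ?f) ?x * (\<Prod>l\<leftarrow>ls. tree_total $ l)))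
       has_sum ps_eval ?f (?x + tree_total)) UNIV"
      by (rule taylor_expansion[OF bounded \<sigma>])
    show "(\<lambda>(t, ts). ?F ts) summable_on ?S"
      using vanishing_imp_summable[OF vanishing_reindex[OF V, of snd ?S]]
      by (auto simp: inj_on_def split_def)
  qed
  also have "?this \<longleftrightarrow> (?F has_sum ps_eval ?f (?x + tree_total)) UNIV"
    by (rule has_sum_reindex_bij_witness[where j = snd and i = "\<lambda>ts. (length ts, ts)"]) auto
  finally show ?thesis by (simp add: mat_eval_def)
qed

text \<open>Applying \<open>\<Lambda> (\<dots> u)\<close> to the expansion of \<open>G (\<Lambda> w + v)\<close> over lists of trees gives, term by
  term, the values of the trees obtained by grafting these lists on a root. Grafting is a
  bijection from lists of trees to trees, so the sum is \<open>v\<close> again.\<close>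

lemma tree_total_equation: "tree_total = \<Lambda> (mat_eval G (\<Lambda> w + tree_total) *v u)"
proof (rule has_sum_vec_unique[OF has_sum_tree_total])
  let ?A = "\<lambda>ts. \<chi> i j. 1 / fact (length ts) * mat_diff G (\<Lambda> w) (map (\<lambda>\<theta>. tree_val \<Lambda> G \<theta> u w) ts) $ i $ j"
  have "((\<lambda>ts. ?A ts *v u) has_sum (mat_eval G (\<Lambda> w + tree_total) *v u)) UNIV"
  proof (rule has_sum_vecI)
    fix i
    have "((\<lambda>ts. \<Sum>j\<in>UNIV. ?A ts $ i $ j * u $ j) has_sum
        (\<Sum>j\<in>UNIV. mat_eval G (\<Lambda> w + tree_total) $ i $ j * u $ j)) UNIV"
      using has_sum_mat_eval_trees by (intro has_sum_sum has_sum_cmult_left) simp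
    then show "((\<lambda>ts. (?A ts *v u) $ i) has_sum (mat_eval G (\<Lambda> w + tree_total) *v u) $ i) UNIV"
      by (simp add: matrix_vector_mult_def)
  qed
  then have "(\<Lambda> \<circ> (\<lambda>ts. ?A ts *v u) has_sum \<Lambda> (mat_eval G (\<Lambda> w + tree_total) *v u)) UNIV"
  proof (rule has_sum_comm_additive_general[rotated 2])
    show "\<Lambda> \<midarrow>x\<rightarrow> \<Lambda> x" for x
      using continuous_\<Lambda>[of UNIV] by (simp add: continuous_on_eq_continuous_at isCont_def)
  qed (simp add: \<Lambda>_sum)
  then have "((\<lambda>ts. tree_val \<Lambda> G (Node ts) u w) has_sum \<Lambda> (mat_eval G (\<Lambda> w + tree_total) *v u)) UNIV"
    by (simp only: tree_val_Node o_def)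
  also have "?this \<longleftrightarrow> ((\<lambda>\<theta>. tree_val \<Lambda> G \<theta> u w) has_sum \<Lambda> (mat_eval G (\<Lambda> w + tree_total) *v u)) UNIV"
    by (rule has_sum_reindex_bij_witness[where j = Node and i = "\<lambda>\<theta>. case \<theta> of Node ts \<Rightarrow> ts"])
       (auto split: rtree.split)
  finally show "((\<lambda>\<theta>. tree_val \<Lambda> G \<theta> u w) has_sum \<Lambda> (mat_eval G (\<Lambda> w + tree_total) *v u)) UNIV" .
qed

lemma tree_solution_equation:
  "tree_solution \<Lambda> G u w = \<Lambda> (w + mat_eval G (tree_solution \<Lambda> G u w) *v u)"
  unfolding tree_solution_eq additive using tree_total_equation by simp

end

lemma mat_eval_lipschitz:
  assumes "x \<in> B0 0 r" "y \<in> B0 0 r"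
  shows "absval (mat_eval G x $ i $ j - mat_eval G y $ i $ j) \<le> M / r * sup_norm (x - y)"
  using ps_eval_lipschitz[OF bounded r_pos assms] by (simp add: mat_eval_def)

text \<open>Changing \<open>h\<close> to \<open>h'\<close> changes \<open>G(h) u\<close> by at most \<open>q \<parallel>h - h'\<parallel>\<close> with \<open>q < 1\<close>. In the
  ultrametric inequality for \<open>\<parallel>h - h'\<parallel>\<close> this contribution cannot be the largest one, so only the
  changes of the data remain. For equal data the estimate is the uniqueness of the solution; in
  general it says that the solution is a Lipschitz function of the data.\<close>

lemma solution_perturbation:
  assumes u: "u \<in> B0 0 (r / M)" and h: "h \<in> B0 0 r" "h' \<in> B0 0 r"
    and eq: "h = \<Lambda> (w + mat_eval G h *v u)" and eq': "h' = \<Lambda> (w' + mat_eval G h' *v u')"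
  shows "sup_norm (h - h') \<le> max (sup_norm (w - w')) (M * sup_norm (u - u'))"
proof (rule ccontr)
  assume "\<not> ?thesis"
  then have large: "sup_norm (w - w') < sup_norm (h - h')" "M * sup_norm (u - u') < sup_norm (h - h')"
    by auto
  define q where "q = M * sup_norm u / r"
  have q: "q < 1" using u M_pos r_pos by (simp add: q_def mem_B0_0 field_simps)
  have "h - h' = \<Lambda> ((w - w') + ((mat_eval G h - mat_eval G h') *v u + mat_eval G h' *v (u - u')))"
  proof -
    have "h - h' = \<Lambda> ((w + mat_eval G h *v u) - (w' + mat_eval G h' *v u'))"
      unfolding \<Lambda>_diff using eq eq' by simp
    also have "(w + mat_eval G h *v u) - (w' + mat_eval G h' *v u')
        = (w - w') + ((mat_eval G h - mat_eval G h') *v u + mat_eval G h' *v (u - u'))"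
      by (simp add: matrix_vector_mult_diff_rdistrib matrix_vector_mult_diff_distrib)
    finally show ?thesis .
  qed
  then have "sup_norm (h - h') \<le> sup_norm ((w - w') + ((mat_eval G h - mat_eval G h') *v u + mat_eval G h' *v (u - u')))"
    using nonexpanding by metis
  also have "\<dots> \<le> max (sup_norm (w - w')) (max (sup_norm ((mat_eval G h - mat_eval G h') *v u)) (sup_norm (mat_eval G h' *v (u - u'))))"
    by (rule order_trans[OF sup_norm_add max.mono[OF order_refl sup_norm_add]])
  finally have "sup_norm (h - h') \<le> sup_norm ((mat_eval G h - mat_eval G h') *v u)
      \<or> sup_norm (h - h') \<le> sup_norm (mat_eval G h' *v (u - u'))"
    using large(1) by (auto simp: max_def split: if_splits)
  moreover have "sup_norm (mat_eval G h' *v (u - u')) \<le> M * sup_norm (u - u')"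
  proof (rule sup_norm_matrix_vector)
    show "absval (mat_eval G h' $ i $ j) \<le> M" for i j
      using ps_eval_bound[OF bounded r_pos, of h' i j] h(2)
      by (simp add: mat_eval_def mem_B0_0 sup_norm_less_iff less_imp_le)
  qed (use M_pos in simp)
  moreover have "sup_norm ((mat_eval G h - mat_eval G h') *v u) \<le> (M / r * sup_norm (h - h')) * sup_norm u"
    by (rule sup_norm_matrix_vector) (use mat_eval_lipschitz[OF h] M_pos r_pos in \<open>auto simp: sup_norm_nonneg\<close>)
  moreover have "(M / r * sup_norm (h - h')) * sup_norm u = q * sup_norm (h - h')"
    by (simp add: q_def)
  moreover have "q * sup_norm (h - h') < sup_norm (h - h')"
    using q large(1) sup_norm_nonneg[of "w - w'"] by simp
  ultimately show False using large(2) by linarith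
qed

lemma solution_unique:
  assumes "u \<in> B0 0 (r / M)" "h \<in> B0 0 r" "h' \<in> B0 0 r"
    and "h = \<Lambda> (w + mat_eval G h *v u)" "h' = \<Lambda> (w + mat_eval G h' *v u)"
  shows "h = h'"
proof -
  have "sup_norm (h - h') \<le> 0" using solution_perturbation[OF assms] by simp
  then have "sup_norm (h - h') = 0" using sup_norm_nonneg[of "h - h'"] by simp
  then show ?thesis using sup_norm_eq_0 by fastforce
qed

lemma continuous_tree_solution:
  "continuous_on (B0 0 (r / M) \<times> B0 0 r) (\<lambda>(u, w). tree_solution \<Lambda> G u w)"
proof -
  let ?D = "(B0 0 (r / M) :: ('k ^ 'l) set) \<times> (B0 0 r :: ('k ^ 'n) set)"
  let ?H = "\<lambda>p. tree_solution \<Lambda> G (fst p) (snd p)"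
  have "continuous_on ?D (\<lambda>p. ?H p $ i)" for i
  proof (rule lipschitz_on_continuous_on[of "max 1 M"], rule lipschitz_onI)
    fix p p' assume p: "p \<in> ?D" and p': "p' \<in> ?D"
    have "dist (?H p $ i) (?H p' $ i) \<le> sup_norm (?H p - ?H p')"
      using absval_le_sup_norm[of "?H p - ?H p'" i] by (simp add: uf_dist)
    also have "\<dots> \<le> max (sup_norm (snd p - snd p')) (M * sup_norm (fst p - fst p'))"
      using p p' by (intro solution_perturbation tree_solution_in_B0 tree_solution_equation) auto
    also have "\<dots> \<le> max 1 M * dist p p'"
    proof (rule max.boundedI)
      have "sup_norm (snd p - snd p') \<le> dist p p'"
        by (rule order_trans[OF sup_norm_le_dist dist_snd_le])
      then show "sup_norm (snd p - snd p') \<le> max 1 M * dist p p'"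
        using mult_right_mono[of 1 "max 1 M" "dist p p'"] by simp
      have "sup_norm (fst p - fst p') \<le> dist p p'"
        by (rule order_trans[OF sup_norm_le_dist dist_fst_le])
      then show "M * sup_norm (fst p - fst p') \<le> max 1 M * dist p p'"
        using M_pos by (intro mult_mono) (auto simp: sup_norm_nonneg)
    qed
    finally show "dist (?H p $ i) (?H p' $ i) \<le> max 1 M * dist p p'" .
  qed simp
  then have "continuous_on ?D (\<lambda>p. \<chi> i. ?H p $ i)" by (rule continuous_on_vec_lambda)
  then show ?thesis by (simp add: split_def)
qed

lemma continuous_mat_diff:
  fixes x :: "'p::topological_space \<Rightarrow> 'k ^ 'n" and X :: "'a \<Rightarrow> 'p \<Rightarrow> 'k ^ 'n"
  assumes x: "continuous_on S x" "x ` S \<subseteq> B0 0 r" and X: "\<And>a. a \<in> set as \<Longrightarrow> continuous_on S (X a)"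
  shows "continuous_on S (\<lambda>p. mat_diff G (x p) (map (\<lambda>a. X a p) as) $ i $ j)"
  unfolding mat_diff_nth length_map
proof (intro continuous_on_sum continuous_on_mult')
  fix ls :: "'n list" assume "ls \<in> {ls. length ls = length as}"
  then have len: "length ls = length as" by simp
  show "continuous_on S (\<lambda>p. ps_eval (foldr ps_partial ls (\<lambda>\<alpha>. G i \<alpha> $ j)) (x p))"
    by (rule continuous_on_compose2[OF continuous_ps_eval[OF ps_bounded_partials[OF bounded r_pos] r_pos] x])
  show "continuous_on S (\<lambda>p. prod_list (map2 (\<lambda>l v. v $ l) ls (map (\<lambda>a. X a p) as)))"
    using len X
  proof (induction ls as rule: list_induct2)
    case (Cons l ls a as)
    then show ?case by (auto intro!: continuous_on_mult' continuous_on_component)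
  qed simp
qed

lemma continuous_tree_val:
  "continuous_on (B0 0 (r / M) \<times> B0 0 r) (\<lambda>(u, w). tree_val \<Lambda> G \<theta> u w)"
proof (induction \<theta>)
  case (Node ts)
  let ?D = "(B0 0 (r / M) :: ('k ^ 'l) set) \<times> (B0 0 r :: ('k ^ 'n) set)"
  let ?X = "\<lambda>\<theta> p. tree_val \<Lambda> G \<theta> (fst p) (snd p)"
  have x: "continuous_on ?D (\<lambda>p. \<Lambda> (snd p))" "(\<lambda>p. \<Lambda> (snd p)) ` ?D \<subseteq> B0 0 r"
    by (rule continuous_on_compose2[OF continuous_\<Lambda>[of UNIV]])
       (auto intro!: continuous_intros \<Lambda>_w_less simp: mem_B0_0)
  have X: "continuous_on ?D (?X \<theta>)" if "\<theta> \<in> set ts" for \<theta>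
    using Node[OF that] by (simp add: split_def)
  have "continuous_on ?D (\<lambda>p. \<chi> i. \<Sum>j\<in>UNIV. 1 / fact (length ts) *
      mat_diff G (\<Lambda> (snd p)) (map (\<lambda>\<theta>. ?X \<theta> p) ts) $ i $ j * fst p $ j)"
    by (intro continuous_on_vec_lambda continuous_on_sum continuous_on_mult' continuous_mat_diff
        continuous_on_const continuous_on_component continuous_on_fst continuous_on_id x X)
  from continuous_on_compose2[OF continuous_\<Lambda>[of UNIV] this]
  show ?case unfolding split_def tree_val_Node by (simp add: matrix_vector_mult_def)
qed

end

section \<open>Existence, uniqueness and continuity of the solution\<close>

text \<open>A non-zero element of the copy of the residue field and its inverse both have absolute value
  at most \<open>1\<close>. As this copy contains the positive integers, these have absolute value \<open>1\<close>.\<close>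

lemma residue_subfield_fact:
  fixes K :: "'k::complete_ultrametric_field set"
  assumes "residue_subfield K"
  shows "1 / fact t \<in> K" "absval (fact t :: 'k) = 1"
proof -
  have sub: "subfield K field_ring" and "K \<subseteq> carrier valuation_ring"
    using assms unfolding residue_subfield_def by blast+
  then have val: "absval x \<le> 1" if "x \<in> K" for x
    using that unfolding valuation_ring_def by simp blast
  interpret K: subfield K "field_ring :: 'k ring" by (rule sub)
  have one: "1 \<in> K"
    using submonoid.one_closed[OF subring.axioms(2)[OF K.subring_axioms]] by (simp add: field_ring_def)
  have add: "x + y \<in> K" if "x \<in> K" "y \<in> K" for x y
    using subgroup.m_closed[OF subring.axioms(1)[OF K.subring_axioms] that] by (simp add: field_ring_def)
  have zero: "0 \<in> K"
    using subgroup.one_closed[OF subring.axioms(1)[OF K.subring_axioms]] by (simp add: field_ring_def)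
  have nat: "of_nat n \<in> K" for n
  proof (induction n)
    case (Suc n)
    then show ?case using add[OF one] by simp
  qed (simp add: zero)
  have "fact t \<in> K" using nat[of "fact t"] by simp
  then have "fact t \<in> K - {\<zero>\<^bsub>field_ring\<^esub>}" by (simp add: field_ring_def)
  then have "fact t \<in> Units (field_ring\<lparr>carrier := K\<rparr>)" unfolding K.subfield_Units .
  then obtain y where y: "y \<in> K" "y * fact t = 1"
    unfolding Units_def field_ring_def by simp blast
  then have y': "y = 1 / fact t" by (simp add: field_simps)
  show "1 / fact t \<in> K" using y(1) y' by simp
  have "absval y * absval (fact t :: 'k) = 1"
    unfolding uf_absval_mult[symmetric] y(2) by simp
  moreover have "absval y * absval (fact t :: 'k) \<le> 1 * absval (fact t :: 'k)"
    by (intro mult_right_mono val[OF y(1)]) simp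
  moreover have "absval (fact t :: 'k) \<le> 1" by (rule val[OF \<open>fact t \<in> K\<close>])
  ultimately show "absval (fact t :: 'k) = 1" by simp
qed

text \<open>The common radius \<open>r\<close> and bound \<open>M\<close> serve for every row of \<open>G\<close>, since shrinking the radius
  decreases the weights.\<close>

lemma ps_converges_imp_bounded:
  fixes F :: "('n::finite \<Rightarrow> nat) \<Rightarrow> 'k::complete_ultrametric_field ^ 'm::finite"
  assumes conv: "ps_converges F \<rho>" and r: "0 < r" "r \<le> \<rho>" and M: "ps_norm F \<rho> \<le> M"
  shows "ps_bounded r M (\<lambda>\<alpha>. F \<alpha> $ j)"
  unfolding ps_bounded_def
proof
  fix \<alpha>
  let ?g = "\<lambda>\<alpha>. sup_norm (F \<alpha>) * \<rho> ^ mdeg \<alpha>"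
  have nonneg: "0 \<le> ?g \<beta>" for \<beta> using r by (simp add: sup_norm_nonneg)
  have "?g \<beta> \<le> infsum ?g UNIV" for \<beta>
    using finite_sum_le_infsum[of ?g UNIV "{\<beta>}"] conv nonneg by (simp add: ps_converges_def)
  then have bdd: "bdd_above (range ?g)" by (intro bdd_aboveI2)
  have "absval (F \<alpha> $ j) * r ^ mdeg \<alpha> \<le> ?g \<alpha>"
    using r by (intro mult_mono power_mono absval_le_sup_norm) (auto simp: sup_norm_nonneg)
  also have "\<dots> \<le> ps_norm F \<rho>"
    unfolding ps_norm_def by (rule cSUP_upper[OF UNIV_I bdd])
  finally show "absval (F \<alpha> $ j) * r ^ mdeg \<alpha> \<le> M" using M by simp
qed

theorem theorem2p3:
  fixes G :: "'n::finite \<Rightarrow> ('n \<Rightarrow> nat) \<Rightarrow> 'k::complete_ultrametric_field ^ 'l::finite"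
    and \<Lambda> :: "'k ^ 'n \<Rightarrow> 'k ^ 'n"
    and K :: "'k set"
    and \<rho> :: "'n \<Rightarrow> real"
    and r M :: real
  assumes residue: "residue_subfield K"
    and additive: "\<And>x y. \<Lambda> (x + y) = \<Lambda> x + \<Lambda> y"
    and linear: "\<And>c x. c \<in> K \<Longrightarrow> \<Lambda> (c *s x) = c *s \<Lambda> x"
    and nonexpanding: "\<And>x. sup_norm (\<Lambda> x) \<le> sup_norm x"
    and radii_pos: "\<And>i. 0 < \<rho> i"
    and conv: "\<And>i. ps_converges (G i) (\<rho> i)"
    and norms_pos: "\<And>i. 0 < ps_norm (G i) (\<rho> i)"
    and r_eq: "r = Min (range \<rho>)"
    and M_eq: "M = Max (range (\<lambda>i. ps_norm (G i) (\<rho> i)))"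
  shows "(\<forall>u \<in> B0 0 (r / M). \<forall>w \<in> B0 0 r.
             tree_solution \<Lambda> G u w \<in> B0 0 r
           \<and> tree_solution \<Lambda> G u w = \<Lambda> (w + mat_eval G (tree_solution \<Lambda> G u w) *v u)
           \<and> (\<forall>h \<in> B0 0 r. h = \<Lambda> (w + mat_eval G h *v u) \<longrightarrow> h = tree_solution \<Lambda> G u w))
       \<and> (\<forall>\<theta>. \<forall>u \<in> B0 0 (r / M). \<forall>w \<in> B0 0 r. tree_val \<Lambda> G \<theta> u w \<in> B0 0 r)
       \<and> (\<forall>\<theta>. continuous_on (B0 0 (r / M) \<times> B0 0 r) (\<lambda>(u, w). tree_val \<Lambda> G \<theta> u w))
       \<and> (\<forall>u \<in> B0 0 (r / M). \<forall>w \<in> B0 0 r. summable (\<lambda>N. tree_level \<Lambda> G u w (Suc N)))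
       \<and> continuous_on (B0 0 (r / M) \<times> B0 0 r) (\<lambda>(u, w). tree_solution \<Lambda> G u w)"
proof -
  have tree: "tree_equation G \<Lambda> r M"
  proof
    show "\<Lambda> ((1 / fact t) *s x) = (1 / fact t) *s \<Lambda> x" for t x
      by (rule linear[OF residue_subfield_fact(1)[OF residue]])
    show "absval (fact t :: 'k) = 1" for t
      by (rule residue_subfield_fact(2)[OF residue])
    show r: "0 < r" using radii_pos by (simp add: r_eq)
    have M: "ps_norm (G i) (\<rho> i) \<le> M" for i by (simp add: M_eq)
    show "0 < M" by (rule less_le_trans[OF norms_pos M])
    show "ps_bounded r M (\<lambda>\<alpha>. G i \<alpha> $ j)" for i j
      by (rule ps_converges_imp_bounded[OF conv r _ M]) (simp add: r_eq)
  qed (rule additive nonexpanding)+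
  interpret tree_equation G \<Lambda> r M by (rule tree)
  show ?thesis
  proof (intro conjI ballI allI impI)
    fix u :: "'k ^ 'l" and w :: "'k ^ 'n" assume uw: "u \<in> B0 0 (r / M)" "w \<in> B0 0 r"
    show "tree_solution \<Lambda> G u w \<in> B0 0 r" by (rule tree_solution_in_B0[OF uw])
    show "tree_solution \<Lambda> G u w = \<Lambda> (w + mat_eval G (tree_solution \<Lambda> G u w) *v u)"
      by (rule tree_solution_equation[OF uw])
    show "h = tree_solution \<Lambda> G u w" if "h \<in> B0 0 r" "h = \<Lambda> (w + mat_eval G h *v u)" for h
      by (rule solution_unique[OF uw(1) that(1) tree_solution_in_B0[OF uw] that(2) tree_solution_equation[OF uw]])
    show "tree_val \<Lambda> G \<theta> u w \<in> B0 0 r" for \<theta> by (rule tree_val_in_B0[OF uw])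
    show "summable (\<lambda>N. tree_level \<Lambda> G u w (Suc N))" by (rule sums_summable[OF tree_level_sums[OF uw]])
  qed (rule continuous_tree_val continuous_tree_solution)+
qed

end
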